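(* Fix an integer $n\ge2$. The posets $\mathsf{ATam}_{312}$, $\mathsf{ATam}_{132}$, $\mathsf{ATam}_{\mathsf{Tree}}$, and $\mathsf{ATam}^{\mathsf{Tree}}$ are finite and self-dual, and they are pairwise isomorphic.
   Context: Fix an integer $n\ge 2$. A translation-invariant total order (TITO) is a total order $\preceq$ on $\mathbb Z$ such that $a\preceq b$ iff $a+n\preceq b+n$. A reflection index is a pair $(a,b)$ of integers with $a<b$, up to simultaneous translation by multiples of $n$; it is an inversion of $\preceq$ if $b\preceq a$, and $\mathrm{Inv}(\preceq)$ is the set of inversions. The Dyer order on TITOs is $\preceq_1\,\le\,\preceq_2$ iff $\mathrm{Inv}(\preceq_1)\subseteq\mathrm{Inv}(\preceq_2)$. A TITO is $312$-avoiding (resp. $132$-avoiding) if there are no integers $a<b<c$ with $c\preceq a\preceq b$ (resp. $a\preceq c\preceq b$). A block of a TITO is a nonempty order-convex subset $I\subseteq\mathbb Z$ with no minimal or maximal element such that all intervals $[a,b]$ with $a,b\in I$ are finite; its size is the number of residue classes modulo $n$ it contains; it is waxing if $a\preceq a+n$ for $a\in I$ and waning otherwise. A TITO is real (resp. co-real) if every block of size $1$ is waxing (resp. waning). $\mathsf{ATam}_{312}$ is the set of $312$-avoiding real TITOs and $\mathsf{ATam}_{132}$ is the set of $132$-avoiding co-real TITOs, each with the Dyer order. A binary tree is a (possibly infinite) plane tree in which each node has at most one left child and at most one right child, each node is the (left or right, not both) child of at most one node (its parent, if it exists), and any two nodes have a common ancestor (each node is an ancestor of itself). The left (right) subtree of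 $v$ consists of the descendants of its left (right) child. In-order: the unique total order on nodes in which, for every $v$, the left subtree of $v$ precedes $v$, which precedes the right subtree of $v$. Post-order: the unique total order in which, for every $v$, the left subtree of $v$ precedes the right subtree of $v$, which precedes $v$. A TIBIT is a binary tree $T$ with node set $\{v_a\mid a\in\mathbb Z\}$ such that $a<b$ iff $v_a$ precedes $v_b$ in in-order, and $v_a$ is the left (resp. right) child of $v_b$ iff $v_{a+n}$ is the left (resp. right) child of $v_{b+n}$. For a TIBIT $T$, $\sqsubseteq_T$ is the TITO obtained by reading node indices in post-order. TIBITs are ordered by $T_1\le T_2$ iff $\sqsubseteq_{T_1}\,\le\,\sqsubseteq_{T_2}$ in the Dyer order. A TIBIT is real if there is no integer $k$ such that $v_{k-n}$ is the parent of $v_k$, and co-real if there is no integer $k$ such that $v_{k+n}$ is the parent of $v_k$. $\mathsf{ATam}_{\mathsf{Tree}}$ (resp. $\mathsf{ATam}^{\mathsf{Tree}}$) is the poset of real (resp. co-real) TIBITs with the induced order. A poset is self-dual if it is isomorphic to its dual. *)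

theory Defs
  imports Main
begin

section \<open>Posets\<close>

type_synonym 'a poset = "'a set \<times> 'a rel"

definition is_poset :: "'a poset \<Rightarrow> bool" where
  "is_poset P \<longleftrightarrow> partial_order_on (fst P) (snd P)"

definition induced_poset :: "'a set \<Rightarrow> ('a \<Rightarrow> 'a \<Rightarrow> bool) \<Rightarrow> 'a poset" where
  "induced_poset A le = (A, {(x, y). x \<in> A \<and> y \<in> A \<and> le x y})"

definition dual_poset :: "'a poset \<Rightarrow> 'a poset" where
  "dual_poset P = (fst P, (snd P)\<inverse>)"

definition poset_isomorphic :: "'a poset \<Rightarrow> 'b poset \<Rightarrow> bool" where
  "poset_isomorphic P Q \<longleftrightarrow>
     (\<exists>f. bij_betw f (fst P) (fst Q) \<and>
          (\<forall>x \<in> fst P. \<forall>y \<in> fst P. (x, y) \<in> snd P \<longleftrightarrow> (f x, f y) \<in> snd Q))"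

definition self_dual :: "'a poset \<Rightarrow> bool" where
  "self_dual P \<longleftrightarrow> poset_isomorphic P (dual_poset P)"


section \<open>Translation-invariant total orders\<close>

text \<open>A total order \<open>r\<close> on the integers is a reflexive relation;
  \<open>(a, b) \<in> r\<close> means that \<open>a\<close> weakly precedes \<open>b\<close>.\<close>

definition tito :: "int \<Rightarrow> int rel \<Rightarrow> bool" where
  "tito n r \<longleftrightarrow> linear_order r \<and> (\<forall>a b. (a, b) \<in> r \<longleftrightarrow> (a + n, b + n) \<in> r)"

definition translation_equiv :: "int \<Rightarrow> (int \<times> int) rel" where
  "translation_equiv n = {((a, b), (a + k * n, b + k * n)) | a b k. True}"

text \<open>A reflection index is an equivalence class of pairs \<open>a < b\<close> under simultaneous
  translation, so sets of inversions are sets of such classes. Pairs with \<open>a\<close>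
  congruent to \<open>b\<close> modulo \<open>n\<close> are included.\<close>

definition Inv :: "int \<Rightarrow> int rel \<Rightarrow> (int \<times> int) set set" where
  "Inv n r = {(a, b). a < b \<and> (b, a) \<in> r} // translation_equiv n"

definition dyer_le :: "int \<Rightarrow> int rel \<Rightarrow> int rel \<Rightarrow> bool" where
  "dyer_le n r s \<longleftrightarrow> Inv n r \<subseteq> Inv n s"

definition avoids_312 :: "int rel \<Rightarrow> bool" where
  "avoids_312 r \<longleftrightarrow> \<not> (\<exists>a b c. a < b \<and> b < c \<and> (c, a) \<in> r \<and> (a, b) \<in> r)"

definition avoids_132 :: "int rel \<Rightarrow> bool" where
  "avoids_132 r \<longleftrightarrow> \<not> (\<exists>a b c. a < b \<and> b < c \<and> (a, c) \<in> r \<and> (c, b) \<in> r)"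

definition is_block :: "int rel \<Rightarrow> int set \<Rightarrow> bool" where
  "is_block r I \<longleftrightarrow>
     I \<noteq> {} \<and>
     (\<forall>a \<in> I. \<forall>b \<in> I. \<forall>x. (a, x) \<in> r \<and> (x, b) \<in> r \<longrightarrow> x \<in> I) \<and>
     \<not> (\<exists>m \<in> I. \<forall>x \<in> I. (x, m) \<in> r \<longrightarrow> x = m) \<and>
     \<not> (\<exists>m \<in> I. \<forall>x \<in> I. (m, x) \<in> r \<longrightarrow> x = m) \<and>
     (\<forall>a \<in> I. \<forall>b \<in> I. finite {x. (a, x) \<in> r \<and> (x, b) \<in> r})"

definition block_size :: "int \<Rightarrow> int set \<Rightarrow> nat" where
  "block_size n I = card {c \<in> {0..<n}. {a. a mod n = c} \<subseteq> I}"

definition waxing :: "int \<Rightarrow> int rel \<Rightarrow> int set \<Rightarrow> bool" where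
  "waxing n r I \<longleftrightarrow> (\<forall>a \<in> I. (a, a + n) \<in> r)"

definition waning :: "int \<Rightarrow> int rel \<Rightarrow> int set \<Rightarrow> bool" where
  "waning n r I \<longleftrightarrow> \<not> waxing n r I"

definition real_tito :: "int \<Rightarrow> int rel \<Rightarrow> bool" where
  "real_tito n r \<longleftrightarrow> tito n r \<and> (\<forall>I. is_block r I \<and> block_size n I = 1 \<longrightarrow> waxing n r I)"

definition coreal_tito :: "int \<Rightarrow> int rel \<Rightarrow> bool" where
  "coreal_tito n r \<longleftrightarrow> tito n r \<and> (\<forall>I. is_block r I \<and> block_size n I = 1 \<longrightarrow> waning n r I)"

definition ATam_312 :: "int \<Rightarrow> int rel poset" where
  "ATam_312 n = induced_poset {r. real_tito n r \<and> avoids_312 r} (dyer_le n)"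

definition ATam_132 :: "int \<Rightarrow> int rel poset" where
  "ATam_132 n = induced_poset {r. coreal_tito n r \<and> avoids_132 r} (dyer_le n)"


section \<open>Binary trees\<close>

text \<open>The node set is the whole type \<open>'v\<close>; a tree is given by its partial
  left-child and right-child functions. It may be infinite and need not have a root.\<close>

datatype 'v bintree = BinTree (lchild: "'v \<Rightarrow> 'v option") (rchild: "'v \<Rightarrow> 'v option")

definition parent_rel :: "'v bintree \<Rightarrow> 'v rel" where
  "parent_rel T = {(p, c). lchild T p = Some c \<or> rchild T p = Some c}"

definition descendants :: "'v bintree \<Rightarrow> 'v \<Rightarrow> 'v set" where
  "descendants T v = {w. (v, w) \<in> (parent_rel T)\<^sup>*}"

definition is_bintree :: "'v bintree \<Rightarrow> bool" where
  "is_bintree T \<longleftrightarrow>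
     acyclic (parent_rel T) \<and>
     (\<forall>p q c. (p, c) \<in> parent_rel T \<and> (q, c) \<in> parent_rel T \<longrightarrow> p = q) \<and>
     (\<forall>p c. \<not> (lchild T p = Some c \<and> rchild T p = Some c)) \<and>
     (\<forall>u v. \<exists>w. u \<in> descendants T w \<and> v \<in> descendants T w)"

definition left_subtree :: "'v bintree \<Rightarrow> 'v \<Rightarrow> 'v set" where
  "left_subtree T v = (case lchild T v of None \<Rightarrow> {} | Some c \<Rightarrow> descendants T c)"

definition right_subtree :: "'v bintree \<Rightarrow> 'v \<Rightarrow> 'v set" where
  "right_subtree T v = (case rchild T v of None \<Rightarrow> {} | Some c \<Rightarrow> descendants T c)"

definition precedes :: "'v rel \<Rightarrow> 'v set \<Rightarrow> 'v set \<Rightarrow> bool" where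
  "precedes r A B \<longleftrightarrow> (\<forall>a \<in> A. \<forall>b \<in> B. (a, b) \<in> r \<and> a \<noteq> b)"

definition in_order :: "'v bintree \<Rightarrow> 'v rel" where
  "in_order T = (THE r. linear_order r \<and>
     (\<forall>v. precedes r (left_subtree T v) {v} \<and> precedes r {v} (right_subtree T v)))"

text \<open>The condition relating the left subtree directly to \<open>v\<close> is needed for nodes \<open>v\<close>
  whose right subtree is empty.\<close>

definition post_order :: "'v bintree \<Rightarrow> 'v rel" where
  "post_order T = (THE r. linear_order r \<and>
     (\<forall>v. precedes r (left_subtree T v) (right_subtree T v) \<and>
          precedes r (left_subtree T v) {v} \<and> precedes r (right_subtree T v) {v}))"


section \<open>Translation-invariant binary in-ordered trees\<close>

text \<open>The node \<open>v\<^sub>a\<close> is identified with its index \<open>a\<close>.\<close>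

definition tibit :: "int \<Rightarrow> int bintree \<Rightarrow> bool" where
  "tibit n T \<longleftrightarrow>
     is_bintree T \<and>
     (\<forall>a b. a < b \<longleftrightarrow> (a, b) \<in> in_order T \<and> a \<noteq> b) \<and>
     (\<forall>a b. lchild T b = Some a \<longleftrightarrow> lchild T (b + n) = Some (a + n)) \<and>
     (\<forall>a b. rchild T b = Some a \<longleftrightarrow> rchild T (b + n) = Some (a + n))"

definition tibit_le :: "int \<Rightarrow> int bintree \<Rightarrow> int bintree \<Rightarrow> bool" where
  "tibit_le n S T \<longleftrightarrow> dyer_le n (post_order S) (post_order T)"

definition real_tibit :: "int \<Rightarrow> int bintree \<Rightarrow> bool" where
  "real_tibit n T \<longleftrightarrow> tibit n T \<and> \<not> (\<exists>k. (k - n, k) \<in> parent_rel T)"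

definition coreal_tibit :: "int \<Rightarrow> int bintree \<Rightarrow> bool" where
  "coreal_tibit n T \<longleftrightarrow> tibit n T \<and> \<not> (\<exists>k. (k + n, k) \<in> parent_rel T)"

definition ATam_real_Tree :: "int \<Rightarrow> int bintree poset" where
  "ATam_real_Tree n = induced_poset {T. real_tibit n T} (tibit_le n)"

definition ATam_coreal_Tree :: "int \<Rightarrow> int bintree poset" where
  "ATam_coreal_Tree n = induced_poset {T. coreal_tibit n T} (tibit_le n)"

end

theory Submission imports Defs begin

text \<open>
  The idea is to replace both trees and total orders by one kind of object: the relation
  ``\<open>c\<close> is a descendant of \<open>p\<close>'' of a TIBIT, as a relation \<open>E\<close> on \<^typ>\<open>int\<close>. Such relations are
  exactly the translation-invariant partial orders in which the descendants of a node form an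
  interval of integers and every finite interval has a topmost element (locale \<open>tree_order\<close>).
  Translation invariance forces the ancestors of a node below a given ancestor to be finite in
  number (\<open>finite_between\<close>), so \<open>E\<close> is the reflexive transitive closure of its covering relation
  and comes from a unique TIBIT. On the other side, reading \<open>E\<close> in post-order and, conversely,
  letting \<open>p\<close> be an ancestor of \<open>c\<close> when \<open>p\<close> is the last of the integers between \<open>p\<close> and \<open>c\<close>
  give mutually inverse maps between these relations and the 312-avoiding TITOs. A block of size
  one is a residue class \<open>k + n\<int>\<close> whose elements follow each other immediately, and in
  post-order \<open>k\<close> is immediately followed by \<open>k - n\<close> exactly if \<open>k - n\<close> is the parent of \<open>k\<close>.
  Hence the two notions of ``real'' agree. The Dyer order becomes inclusion of the right descents
  \<open>a < b\<close>, \<open>(a, b) \<in> E\<close>.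

  Two facts about these relations then carry the theorem.

  \<^item> Left-right duality: fewer right descents means more left descents. The topmost element of
    \<open>[a, b]\<close> decides both, and reading this off takes a few lines
    (\<open>left_descent_transfer\<close>). So negating all labels is an isomorphism from the
    real relations to the dual of the co-real ones.

  \<^item> A real relation is determined, and so is the order between two of them, by the
    near descents, those with \<open>b < a + n\<close> (\<open>real_order_near_generates\<close>); by duality the same holds
    for co-real relations. The sets of near descents that occur are the same in both cases: if
    \<open>s + n\<close> is the parent of \<open>s\<close>, the infinite chain of all \<open>s + j n\<close> can be turned upside down,
    which changes no near descent (\<open>coreal_order_with_same_near_descents\<close>). So the real and
    the co-real relations form isomorphic posets.

  Together the real relations form a self-dual poset, to which all four posets are isomorphic;
  for 132-avoiding orders, negation of the labels reduces the claim to 312-avoiding ones.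
  Finiteness holds because the near descents starting in \<open>{0..<n}\<close> already determine a real relation.
\<close>

section \<open>Isomorphisms of posets\<close>

lemma poset_isomorphicI:
  assumes "bij_betw f A B" "\<And>x y. x \<in> A \<Longrightarrow> y \<in> A \<Longrightarrow> le x y \<longleftrightarrow> le' (f x) (f y)"
  shows "poset_isomorphic (induced_poset A le) (induced_poset B le')"
  unfolding poset_isomorphic_def induced_poset_def
  using assms bij_betwE[OF assms(1)] by (intro exI[of _ f]) auto

lemma dual_poset_induced [simp]: "dual_poset (induced_poset A le) = induced_poset A (\<lambda>x y. le y x)"
  by (auto simp: dual_poset_def induced_poset_def)

lemma poset_isomorphic_sym:
  assumes "poset_isomorphic P Q" shows "poset_isomorphic Q P"
proof -
  obtain f where f: "bij_betw f (fst P) (fst Q)"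
    "\<And>x y. x \<in> fst P \<Longrightarrow> y \<in> fst P \<Longrightarrow> (x, y) \<in> snd P \<longleftrightarrow> (f x, f y) \<in> snd Q"
    using assms by (auto simp: poset_isomorphic_def)
  let ?g = "inv_into (fst P) f"
  have "bij_betw ?g (fst Q) (fst P)" using f(1) by (rule bij_betw_inv_into)
  moreover have "(x, y) \<in> snd Q \<longleftrightarrow> (?g x, ?g y) \<in> snd P" if "x \<in> fst Q" "y \<in> fst Q" for x y
    using f(2)[of "?g x" "?g y"] that bij_betw_inv_into_right[OF f(1)]
      bij_betwE[OF \<open>bij_betw ?g (fst Q) (fst P)\<close>] by simp
  ultimately show ?thesis unfolding poset_isomorphic_def by blast
qed

lemma poset_isomorphic_trans:
  assumes "poset_isomorphic P Q" "poset_isomorphic Q R" shows "poset_isomorphic P R"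
proof -
  obtain f where f: "bij_betw f (fst P) (fst Q)"
    "\<And>x y. x \<in> fst P \<Longrightarrow> y \<in> fst P \<Longrightarrow> (x, y) \<in> snd P \<longleftrightarrow> (f x, f y) \<in> snd Q"
    using assms(1) by (auto simp: poset_isomorphic_def)
  obtain g where g: "bij_betw g (fst Q) (fst R)"
    "\<And>x y. x \<in> fst Q \<Longrightarrow> y \<in> fst Q \<Longrightarrow> (x, y) \<in> snd Q \<longleftrightarrow> (g x, g y) \<in> snd R"
    using assms(2) by (auto simp: poset_isomorphic_def)
  have "bij_betw (g \<circ> f) (fst P) (fst R)" using f(1) g(1) by (rule bij_betw_trans)
  moreover have "(x, y) \<in> snd P \<longleftrightarrow> ((g \<circ> f) x, (g \<circ> f) y) \<in> snd R"
    if "x \<in> fst P" "y \<in> fst P" for x y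
    using f(2)[OF that] g(2) bij_betwE[OF f(1)] that by simp
  ultimately show ?thesis unfolding poset_isomorphic_def by blast
qed

lemma poset_isomorphic_dual:
  "poset_isomorphic P Q \<Longrightarrow> poset_isomorphic (dual_poset P) (dual_poset Q)"
  unfolding poset_isomorphic_def dual_poset_def by auto

lemma self_dual_iso:
  assumes "poset_isomorphic P Q" "self_dual Q" shows "self_dual P"
proof -
  have "poset_isomorphic P (dual_poset Q)"
    using assms(1) assms(2)[unfolded self_dual_def] by (rule poset_isomorphic_trans)
  moreover have "poset_isomorphic (dual_poset Q) (dual_poset P)"
    by (rule poset_isomorphic_dual[OF poset_isomorphic_sym[OF assms(1)]])
  ultimately show ?thesis unfolding self_dual_def by (rule poset_isomorphic_trans)
qed

lemma finite_iso: "poset_isomorphic P Q \<Longrightarrow> finite (fst Q) \<Longrightarrow> finite (fst P)"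
  unfolding poset_isomorphic_def using bij_betw_finite by blast

lemma is_poset_iso:
  assumes "poset_isomorphic P Q" "is_poset Q" "snd P \<subseteq> fst P \<times> fst P"
  shows "is_poset P"
proof -
  obtain f where f: "bij_betw f (fst P) (fst Q)"
    and le: "\<And>x y. x \<in> fst P \<Longrightarrow> y \<in> fst P \<Longrightarrow> (x, y) \<in> snd P \<longleftrightarrow> (f x, f y) \<in> snd Q"
    using assms(1) by (auto simp: poset_isomorphic_def)
  have Q: "refl_on (fst Q) (snd Q)" "trans (snd Q)" "antisym (snd Q)"
    using assms(2) partial_order_onD by (auto simp: is_poset_def)
  have carrier: "x \<in> fst P" "y \<in> fst P" if "(x, y) \<in> snd P" for x y
    using assms(3) that by auto
  have "refl_on (fst P) (snd P)"
    using Q(1) le bij_betwE[OF f] by (auto simp: refl_on_def)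
  moreover have "trans (snd P)"
    using transD[OF Q(2)] le carrier by (intro transI) blast
  moreover have "antisym (snd P)"
  proof (rule antisymI)
    fix x y assume "(x, y) \<in> snd P" "(y, x) \<in> snd P"
    then show "x = y"
      using antisymD[OF Q(3), of "f x" "f y"] le carrier bij_betw_imp_inj_on[OF f]
      by (meson inj_onD)
  qed
  ultimately show ?thesis
    using assms(3) by (simp add: is_poset_def partial_order_on_def preorder_on_def)
qed

section \<open>Shifts, adjacency and negation\<close>

text \<open>Used for two kinds of relations: in a descendant relation it says that \<open>x\<close> is the parent of \<open>y\<close>,
in a total order that \<open>y\<close> is the immediate successor of \<open>x\<close>.\<close>

definition adjacent :: "'a rel \<Rightarrow> 'a \<Rightarrow> 'a \<Rightarrow> bool" where
  "adjacent r x y \<longleftrightarrow> x \<noteq> y \<and> (x, y) \<in> r \<and> (\<forall>z. (x, z) \<in> r \<and> (z, y) \<in> r \<longrightarrow> z = x \<or> z = y)"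

lemma shift_invariant_multiple:
  fixes n :: int
  assumes "\<And>a b. (a + n, b + n) \<in> r \<longleftrightarrow> (a, b) \<in> r"
  shows "(a + j * n, b + j * n) \<in> r \<longleftrightarrow> (a, b) \<in> r"
proof -
  have nat: "(a + int k * n, b + int k * n) \<in> r \<longleftrightarrow> (a, b) \<in> r" for a b and k :: nat
  proof (induction k)
    case (Suc k)
    have "(a + int (Suc k) * n, b + int (Suc k) * n)
        = (a + int k * n + n, b + int k * n + n)"
      by (simp add: algebra_simps)
    then show ?case using assms Suc by metis
  qed simp
  show ?thesis
  proof (cases "0 \<le> j")
    case True
    then show ?thesis using nat[of a "nat j" b] by simp
  next
    case False
    then show ?thesis using nat[of "a + j * n" "nat (- j)" "b + j * n"] by simp
  qed
qed

lemma adjacent_shift_multiple: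
  fixes n :: int
  assumes "\<And>a b. (a + n, b + n) \<in> r \<longleftrightarrow> (a, b) \<in> r"
  shows "adjacent r (a + j * n) (b + j * n) \<longleftrightarrow> adjacent r a b"
proof -
  have "(\<forall>z. P (z + j * n)) \<longleftrightarrow> (\<forall>z. P z)" for P :: "int \<Rightarrow> bool"
    by (metis diff_add_cancel)
  note this[of "\<lambda>z. (a + j * n, z) \<in> r \<and> (z, b + j * n) \<in> r \<longrightarrow> z = a + j * n \<or> z = b + j * n"]
  then show ?thesis
    using shift_invariant_multiple[of n r] assms by (simp add: adjacent_def)
qed

text \<open>Negating the labels exchanges left and right in a tree, and waxing and waning in a total order.\<close>

definition mirror :: "int rel \<Rightarrow> int rel" where
  "mirror r = {(a, b). (- a, - b) \<in> r}"

lemma mirror_iff [simp]: "(a, b) \<in> mirror r \<longleftrightarrow> (- a, - b) \<in> r"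
  by (simp add: mirror_def)

lemma mirror_mirror [simp]: "mirror (mirror r) = r"
  by (auto simp: mirror_def)

lemma adjacent_mirror: "adjacent (mirror r) a b \<longleftrightarrow> adjacent r (- a) (- b)"
proof -
  have "(\<forall>z. P (- z)) \<longleftrightarrow> (\<forall>z. P z)" for P :: "int \<Rightarrow> bool"
    by (metis minus_minus)
  note this[of "\<lambda>z. (- a, z) \<in> r \<and> (z, - b) \<in> r \<longrightarrow> z = - a \<or> z = - b"]
  then show ?thesis by (simp add: adjacent_def)
qed

section \<open>Descendant relations of in-ordered trees\<close>

text \<open>Here \<open>(p, c) \<in> E\<close> is to be read as: \<open>c\<close> is a descendant of \<open>p\<close>. Convexity says that a subtree is
an interval in in-order, and \<open>top\<close> that the closest common ancestor of \<open>a\<close> and \<open>b\<close> lies between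
them in in-order. The axioms are invariant under negating all labels, which saves half of many
arguments below.\<close>

locale tree_order =
  fixes n :: int and E :: "int rel"
  assumes n_pos: "0 < n"
    and refl: "(a, a) \<in> E"
    and antisym: "(a, b) \<in> E \<Longrightarrow> (b, a) \<in> E \<Longrightarrow> a = b"
    and trans: "(a, b) \<in> E \<Longrightarrow> (b, c) \<in> E \<Longrightarrow> (a, c) \<in> E"
    and convex_right: "(p, c) \<in> E \<Longrightarrow> p \<le> x \<Longrightarrow> x \<le> c \<Longrightarrow> (p, x) \<in> E"
    and convex_left: "(p, c) \<in> E \<Longrightarrow> c \<le> x \<Longrightarrow> x \<le> p \<Longrightarrow> (p, x) \<in> E"
    and top: "a \<le> b \<Longrightarrow> \<exists>m. a \<le> m \<and> m \<le> b \<and> (m, a) \<in> E \<and> (m, b) \<in> E"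
    and shift: "(a + n, b + n) \<in> E \<longleftrightarrow> (a, b) \<in> E"

context tree_order
begin

lemma shift_multiple: "(a + j * n, b + j * n) \<in> E \<longleftrightarrow> (a, b) \<in> E"
  using shift_invariant_multiple[of n E] shift by blast

lemma tree_order_mirror: "tree_order n (mirror E)"
proof
  show "\<exists>m\<ge>a. m \<le> b \<and> (m, a) \<in> mirror E \<and> (m, b) \<in> mirror E" if "a \<le> b" for a b
  proof -
    obtain m where "- b \<le> m" "m \<le> - a" "(m, - b) \<in> E" "(m, - a) \<in> E"
      using top[of "- b" "- a"] \<open>a \<le> b\<close> by auto
    then show ?thesis by (intro exI[of _ "- m"]) auto
  qed
  show "(a + n, b + n) \<in> mirror E \<longleftrightarrow> (a, b) \<in> mirror E" for a b
    using shift[of "- a - n" "- b - n"] by (simp add: algebra_simps)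
  show "(p, x) \<in> mirror E" if "(p, c) \<in> mirror E" "p \<le> x" "x \<le> c" for p c x
    using convex_left[of "- p" "- c" "- x"] that by simp
  show "(p, x) \<in> mirror E" if "(p, c) \<in> mirror E" "c \<le> x" "x \<le> p" for p c x
    using convex_right[of "- p" "- c" "- x"] that by simp
  show "a = b" if "(a, b) \<in> mirror E" "(b, a) \<in> mirror E" for a b
    using antisym that by fastforce
  show "(a, c) \<in> mirror E" if "(a, b) \<in> mirror E" "(b, c) \<in> mirror E" for a b c
    using trans that by simp
qed (simp_all add: n_pos refl)

text \<open>If \<open>m\<close> is the topmost element between two ancestors \<open>x\<close> and \<open>y\<close> of \<open>a\<close>, then \<open>m\<close> lies
between \<open>a\<close> and one of them. By convexity that one is an ancestor of \<open>m\<close>, hence equal to \<open>m\<close>.\<close>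

lemma ancestors_comparable:
  assumes "(x, a) \<in> E" "(y, a) \<in> E" shows "(x, y) \<in> E \<or> (y, x) \<in> E"
proof -
  have "(x, y) \<in> E \<or> (y, x) \<in> E" if "(x, a) \<in> E" "(y, a) \<in> E" "x \<le> y" for x y
  proof -
    obtain m where m: "x \<le> m" "m \<le> y" "(m, x) \<in> E" "(m, y) \<in> E"
      using top[OF \<open>x \<le> y\<close>] by blast
    have "(x, m) \<in> E \<or> (y, m) \<in> E"
    proof (cases "m \<le> a")
      case True
      then show ?thesis using convex_right[OF that(1) m(1)] by simp
    next
      case False
      then show ?thesis using convex_left[OF that(2)] m(2) by simp
    qed
    then show ?thesis using m antisym by blast
  qed
  then show ?thesis using assms by (cases x y rule: le_cases) blast+
qed

text \<open>Translating a descent from \<open>a\<close> to \<open>a + j n\<close> and composing gives descents to every \<open>a + k j n\<close>,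
and convexity fills the gaps.\<close>

lemma descendants_all_right:
  assumes "(a, a + j * n) \<in> E" "0 < j" "a \<le> x" shows "(a, x) \<in> E"
proof -
  have "(a, a + int k * (j * n)) \<in> E" for k
  proof (induction k)
    case (Suc k)
    have "(a + int k * (j * n), a + j * n + int k * (j * n)) \<in> E"
      using assms(1) shift_multiple[of a "int k * j" "a + j * n"] by (simp add: algebra_simps)
    from trans[OF Suc this] show ?case by (simp add: algebra_simps)
  qed (simp add: refl)
  from this[of "nat (x - a)"] have "(a, a + (x - a) * (j * n)) \<in> E" using assms by simp
  moreover have "(x - a) * 1 \<le> (x - a) * (j * n)"
    using assms n_pos by (intro mult_left_mono) (auto simp: int_one_le_iff_zero_less)
  ultimately show ?thesis using convex_right assms(3) by fastforce
qed

end

lemma infinite_int_congruent_pair: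
  fixes n :: int
  assumes "infinite A" "0 < n"
  obtains x j where "x \<in> A" "x + j * n \<in> A" "0 < j"
proof -
  have "finite ((\<lambda>x. x mod n) ` A)"
    by (rule finite_subset[of _ "{0..<n}"]) (use assms in auto)
  with assms(1) obtain x where "x \<in> A" "infinite {y \<in> A. y mod n = x mod n}"
    using pigeonhole_infinite by blast
  then obtain y where "y \<in> A" "y mod n = x mod n" "y \<noteq> x"
    by (metis (mono_tags, lifting) finite.emptyI finite_insert finite_subset insertI1 mem_Collect_eq
        subsetI)
  then obtain u v where uv: "u \<in> A" "v \<in> A" "u < v" "v mod n = u mod n"
    using \<open>x \<in> A\<close> by (metis linorder_neqE)
  then obtain j where "v = u + j * n"
    by (metis mod_eqE mult.commute diff_eq_eq add.commute)
  then show thesis using uv assms(2) that[of u j] by (simp add: zero_less_mult_iff)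
qed

context tree_order
begin

text \<open>Among infinitely many ancestors of \<open>a\<close> to its left, two are congruent modulo \<open>n\<close>. The lower label
then has everything to its right as a descendant, including its own ancestor \<open>m\<close>.\<close>

lemma no_infinite_chain_left:
  "finite {x. x < a \<and> x < m \<and> (m, x) \<in> E \<and> (x, a) \<in> E}" (is "finite ?A")
proof (rule ccontr)
  assume "infinite ?A"
  then obtain y j where y: "y \<in> ?A" "y + j * n \<in> ?A" "0 < j"
    using n_pos infinite_int_congruent_pair by blast
  then have "(y, y + j * n) \<in> E"
    using convex_right[of y a "y + j * n"] n_pos by simp
  then have "(y, m) \<in> E"
    using descendants_all_right y by simp
  then show False using y antisym by force
qed

end

text \<open>This is what makes parents exist: it replaces the local finiteness that is built into the definition
of a tree.\<close>

lemma (in tree_order) finite_between: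
  "finite {x. (m, x) \<in> E \<and> (x, a) \<in> E}"
proof -
  interpret M: tree_order n "mirror E" by (rule tree_order_mirror)
  let ?R = "{x. a < x \<and> m < x \<and> (m, x) \<in> E \<and> (x, a) \<in> E}"
  have "?R \<subseteq> uminus ` {x. x < - a \<and> x < - m \<and> (- m, x) \<in> mirror E \<and> (x, - a) \<in> mirror E}"
    by (auto intro!: image_eqI[of _ _ "- x" for x])
  then have "finite ?R"
    using M.no_infinite_chain_left finite_surj by blast
  moreover have "{x. (m, x) \<in> E \<and> (x, a) \<in> E} \<subseteq> {min a m..max a m} \<union> ?R
      \<union> {x. x < a \<and> x < m \<and> (m, x) \<in> E \<and> (x, a) \<in> E}"
    by auto
  ultimately show ?thesis
    using no_infinite_chain_left by (meson finite_UnI finite_atLeastAtMost_int finite_subset)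
qed

section \<open>Descents and left-right duality\<close>

definition right_descents :: "int rel \<Rightarrow> int rel" where
  "right_descents E = {(a, b). a < b \<and> (a, b) \<in> E}"

text \<open>Bounding the distance by a period makes the set blind to the direction of an infinite chain of
congruent nodes, and this direction is what tells a real relation from a co-real one.\<close>

definition near_descents :: "int \<Rightarrow> int rel \<Rightarrow> int rel" where
  "near_descents n E = {(a, b). a < b \<and> b < a + n \<and> (a, b) \<in> E}"

text \<open>Suppose that \<open>b\<close> is above \<open>a\<close> in \<open>F\<close>. If the topmost element \<open>m\<close> of \<open>[a, b]\<close> in \<open>E\<close> were not
\<open>b\<close>, then \<open>(m, b)\<close> would be a right descent of \<open>E\<close>, hence of \<open>F\<close>, although \<open>b\<close> lies above \<open>m\<close> in
\<open>F\<close>. Only right descents within \<open>[a, b]\<close> enter, so the same lemma serves for near descents.\<close>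

lemma left_descent_transfer:
  assumes "tree_order n E" "tree_order n F" "a < b" "(b, a) \<in> F"
    and sub: "\<And>x. a \<le> x \<Longrightarrow> x < b \<Longrightarrow> (x, b) \<in> E \<Longrightarrow> (x, b) \<in> F"
  shows "(b, a) \<in> E"
proof -
  interpret E: tree_order n E by fact
  interpret F: tree_order n F by fact
  obtain m where m: "a \<le> m" "m \<le> b" "(m, a) \<in> E" "(m, b) \<in> E"
    using E.top[of a b] \<open>a < b\<close> by auto
  have "m = b"
  proof (rule ccontr)
    assume "m \<noteq> b"
    then have "(m, b) \<in> F" using sub m by simp
    moreover have "(b, m) \<in> F" using F.convex_left[OF \<open>(b, a) \<in> F\<close>] m by simp
    ultimately show False using F.antisym \<open>m \<noteq> b\<close> by blast
  qed
  then show ?thesis using m by simp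
qed

lemma right_descent_transfer:
  assumes "tree_order n E" "tree_order n F" "a < b" "(a, b) \<in> F"
    and "\<And>x. a < x \<Longrightarrow> x \<le> b \<Longrightarrow> (x, a) \<in> E \<Longrightarrow> (x, a) \<in> F"
  shows "(a, b) \<in> E"
  using left_descent_transfer[of n "mirror E" "mirror F" "- b" "- a"] assms
    tree_order.tree_order_mirror by simp

lemma right_descents_mirror_subset_iff:
  assumes "tree_order n E" "tree_order n F"
  shows "right_descents (mirror F) \<subseteq> right_descents (mirror E)
    \<longleftrightarrow> right_descents E \<subseteq> right_descents F"
proof
  assume sub: "right_descents (mirror F) \<subseteq> right_descents (mirror E)"
  have left: "(x, a) \<in> E" if "a < x" "(x, a) \<in> F" for a x
    using subsetD[OF sub, of "(- x, - a)"] that by (simp add: right_descents_def)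
  show "right_descents E \<subseteq> right_descents F"
    using right_descent_transfer[OF assms(2,1)] left by (auto simp: right_descents_def)
next
  assume sub: "right_descents E \<subseteq> right_descents F"
  have right: "(x, b) \<in> F" if "x < b" "(x, b) \<in> E" for b x
    using subsetD[OF sub, of "(x, b)"] that by (simp add: right_descents_def)
  show "right_descents (mirror F) \<subseteq> right_descents (mirror E)"
    using left_descent_transfer[OF assms] right by (auto simp: right_descents_def)
qed

lemma near_descents_mirror_subset:
  assumes "tree_order n E" "tree_order n F" "near_descents n E \<subseteq> near_descents n F"
  shows "near_descents n (mirror F) \<subseteq> near_descents n (mirror E)"
proof -
  have right: "(x, b) \<in> F" if "x < b" "b < x + n" "(x, b) \<in> E" for b x
    using subsetD[OF assms(3), of "(x, b)"] that by (simp add: near_descents_def)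
  show ?thesis
    using left_descent_transfer[OF assms(1,2)] right by (auto simp: near_descents_def)
qed

text \<open>By duality the right descents determine the left ones.\<close>

lemma tree_order_eqI:
  assumes "tree_order n E" "tree_order n F" "right_descents E = right_descents F"
  shows "E = F"
proof -
  have *: "(a, b) \<in> F"
    if "tree_order n E" "tree_order n F" "right_descents E = right_descents F" "(a, b) \<in> E"
    for E F a b
  proof -
    have "right_descents (mirror E) \<subseteq> right_descents (mirror F)"
      using right_descents_mirror_subset_iff[OF that(2,1)] that(3) by simp
    from subsetD[OF this, of "(- a, - b)"] subsetD[OF equalityD1[OF that(3)], of "(a, b)"]
    show ?thesis
      using that(4) tree_order.refl[OF that(2)]
      by (cases a b rule: linorder_cases) (auto simp: right_descents_def)
  qed
  show ?thesis using *[OF assms] *[OF assms(2,1) assms(3)[symmetric]] by auto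
qed

section \<open>Real and co-real descendant relations\<close>

definition real_order :: "int \<Rightarrow> int rel \<Rightarrow> bool" where
  "real_order n E \<longleftrightarrow> tree_order n E \<and> (\<forall>k. \<not> adjacent E (k - n) k)"

definition coreal_order :: "int \<Rightarrow> int rel \<Rightarrow> bool" where
  "coreal_order n E \<longleftrightarrow> tree_order n E \<and> (\<forall>k. \<not> adjacent E (k + n) k)"

lemma coreal_order_mirror [simp]: "coreal_order n (mirror E) \<longleftrightarrow> real_order n E"
proof -
  have "(\<forall>k. P (- k)) \<longleftrightarrow> (\<forall>k. P k)" for P :: "int \<Rightarrow> bool"
    by (metis minus_minus)
  note this[of "\<lambda>k. \<not> adjacent E (k - n) k"]
  moreover have "tree_order n (mirror E) \<longleftrightarrow> tree_order n E"
    using tree_order.tree_order_mirror mirror_mirror by metis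
  ultimately show ?thesis
    by (simp add: coreal_order_def real_order_def adjacent_mirror)
qed

lemma real_order_mirror [simp]: "real_order n (mirror E) \<longleftrightarrow> coreal_order n E"
  using coreal_order_mirror[of n "mirror E"] by simp

text \<open>A descent from \<open>a\<close> over at least one period implies one to \<open>a + n\<close> and then to everything on the
right, so it suffices to factor the descent from \<open>a\<close> to \<open>a + n\<close> into near ones. Since \<open>E\<close> is real,
\<open>a\<close> is not the parent of \<open>a + n\<close>, and any node strictly between them in the tree must lie strictly
between them as an integer.\<close>

lemma real_order_near_generates:
  assumes "real_order n E" "tree_order n F"
    and near: "near_descents n E \<subseteq> near_descents n F"
  shows "right_descents E \<subseteq> right_descents F"
proof -
  interpret E: tree_order n E using assms(1) by (simp add: real_order_def)
  interpret F: tree_order n F by fact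
  have near': "(a, b) \<in> F" if "a < b" "b < a + n" "(a, b) \<in> E" for a b
    using subsetD[OF near, of "(a, b)"] that by (simp add: near_descents_def)
  have period: "(a, a + n) \<in> F" if a: "(a, a + n) \<in> E" for a
  proof -
    have "\<not> adjacent E a (a + n)"
      using assms(1) by (auto simp: real_order_def dest: spec[of _ "a + n"])
    then obtain p where p: "(a, p) \<in> E" "(p, a + n) \<in> E" "p \<noteq> a" "p \<noteq> a + n"
      using a E.n_pos by (auto simp: adjacent_def)
    have "a < p"
      using E.convex_right[OF p(2), of a] p E.antisym E.n_pos by force
    moreover have "p < a + n"
    proof (rule ccontr)
      assume "\<not> p < a + n"
      then have "(a, p - n) \<in> E" using E.convex_right[OF p(1), of "p - n"] E.n_pos by simp
      moreover have "(p - n, a) \<in> E" using E.shift[of "p - n" a] p by simp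
      ultimately show False using E.antisym p by force
    qed
    ultimately show ?thesis using near' p F.trans by fastforce
  qed
  have "(a, b) \<in> F" if "a < b" "(a, b) \<in> E" for a b
  proof (cases "b < a + n")
    case True
    then show ?thesis using near' that by simp
  next
    case False
    then have "(a, a + n) \<in> E" using E.convex_right that E.n_pos by force
    then show ?thesis
      using period F.descendants_all_right[of a 1 b] that by simp
  qed
  then show ?thesis by (auto simp: right_descents_def)
qed

lemma near_descents_mono:
  "right_descents E \<subseteq> right_descents F \<Longrightarrow> near_descents n E \<subseteq> near_descents n F"
  by (auto simp: right_descents_def near_descents_def)

lemma real_order_right_descents_subset_iff:
  assumes "real_order n E" "real_order n F"
  shows "right_descents E \<subseteq> right_descents F \<longleftrightarrow> near_descents n E \<subseteq> near_descents n F"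
  using assms real_order_near_generates near_descents_mono unfolding real_order_def by blast

lemma near_descents_mirror_subset_iff:
  assumes "tree_order n E" "tree_order n F"
  shows "near_descents n (mirror F) \<subseteq> near_descents n (mirror E)
    \<longleftrightarrow> near_descents n E \<subseteq> near_descents n F"
  using near_descents_mirror_subset[of n E F] near_descents_mirror_subset[of n "mirror F" "mirror E"]
    assms tree_order.tree_order_mirror by auto

text \<open>Obtained from the real case: mirroring reverses both inclusions.\<close>

lemma coreal_order_right_descents_subset_iff:
  assumes "coreal_order n E" "coreal_order n F"
  shows "right_descents E \<subseteq> right_descents F \<longleftrightarrow> near_descents n E \<subseteq> near_descents n F"
proof -
  have "tree_order n E" "tree_order n F" using assms by (simp_all add: coreal_order_def)
  then show ?thesis
    using right_descents_mirror_subset_iff near_descents_mirror_subset_iff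
      real_order_right_descents_subset_iff[of n "mirror F" "mirror E"] assms by simp
qed

text \<open>If \<open>E\<close> is not co-real, some \<open>s + n\<close> is the parent of \<open>s\<close>. Then the nodes congruent to \<open>s\<close> form the
spine of the tree: each of them has as descendants all labels below its successor \<open>p + n\<close> on the
spine, and all other nodes have their descendants strictly between two consecutive spine nodes.
Turning the spine upside down means letting each spine node \<open>p\<close> have all labels
above \<open>p - n\<close> as descendants, and it changes nothing else.\<close>

lemma coreal_order_with_same_near_descents:
  assumes "real_order n E"
  obtains E' where "coreal_order n E'" "near_descents n E' = near_descents n E"
proof (cases "coreal_order n E")
  case True
  then show thesis using that by blast
next
  case False
  interpret tree_order n E using assms by (simp add: real_order_def)
  obtain s where s: "adjacent E (s + n) s"
    using False assms by (auto simp: coreal_order_def real_order_def)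
  \<comment> \<open>\<open>C\<close> is the set of spine nodes, the residue class of \<open>s\<close>.\<close>
  define C where "C p \<longleftrightarrow> n dvd p - s" for p
  have C_shift: "C (p + n) \<longleftrightarrow> C p" "C (p - n) \<longleftrightarrow> C p" for p
  proof -
    show "C (p + n) \<longleftrightarrow> C p" unfolding C_def
      using dvd_add_left_iff[of n n "p - s"] by (simp add: algebra_simps)
    show "C (p - n) \<longleftrightarrow> C p" unfolding C_def
      using dvd_add_left_iff[of n n "p - n - s"] by (simp add: algebra_simps)
  qed
  have C_gap: "p + n \<le> q" if "C p" "C q" "p < q" for p q
  proof -
    have "n dvd q - p" using that(1,2) dvd_diff[of n "q - s" "p - s"] by (simp add: C_def)
    then show ?thesis using zdvd_imp_le[of n "q - p"] that(3) by simp
  qed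
  have C_below: "\<exists>p. C p \<and> p \<le> q \<and> q < p + n" for q
  proof (intro exI conjI)
    show "C (q - (q - s) mod n)"
      using dvd_minus_mod[of n "q - s"] by (simp add: C_def algebra_simps)
  qed (use n_pos in simp_all)
  have C_adjacent: "adjacent E (p + n) p" if "C p" for p
  proof -
    obtain j where "p - s = n * j"
      using \<open>C p\<close> unfolding C_def by (rule dvdE)
    then have j: "p = s + j * n"
      by (simp add: algebra_simps)
    show ?thesis
      using adjacent_shift_multiple[of n E "s + n" j s] shift s by (simp add: j ac_simps)
  qed
  have C_descendants: "(p, c) \<in> E \<longleftrightarrow> c < p + n" if "C p" for p c
  proof
    have adj: "adjacent E (p + n) p" using that C_adjacent by blast
    show "(p, c) \<in> E \<Longrightarrow> c < p + n"
      using convex_right[of p c "p + n"] adj antisym n_pos by (force simp: adjacent_def)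
    assume "c < p + n"
    show "(p, c) \<in> E"
    proof (cases "c \<le> p")
      case True
      interpret M: tree_order n "mirror E" by (rule tree_order_mirror)
      have "(- p, - p + 1 * n) \<in> mirror E"
        using adj shift[of p "p - n"] by (simp add: adjacent_def)
      from M.descendants_all_right[OF this, of "- c"] True show ?thesis by simp
    next
      case False
      then obtain m where m: "p \<le> m" "m \<le> c" "(m, p) \<in> E" "(m, c) \<in> E"
        using top[of p c] by auto
      have "(p + n, m) \<in> E"
        using convex_left[of "p + n" p m] adj m \<open>c < p + n\<close> by (simp add: adjacent_def)
      then have "m = p"
        using adj m \<open>c < p + n\<close> by (auto simp: adjacent_def)
      then show ?thesis using m by simp
    qed
  qed
  have inner: "p < c \<and> c < p + n" if "C p" "p < q" "q < p + n" "(q, c) \<in> E" for p q c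
  proof -
    have q: "(p, q) \<in> E" "(p + n, q) \<in> E"
      using C_descendants[of p q] C_descendants[of "p + n" q] that C_shift n_pos by auto
    have "p < c"
    proof (rule ccontr)
      assume "\<not> p < c"
      then have "(q, p) \<in> E" using convex_left[OF that(4), of p] that by simp
      then show False using antisym q that by force
    qed
    moreover have "c < p + n"
    proof (rule ccontr)
      assume "\<not> c < p + n"
      then have "(q, p + n) \<in> E" using convex_right[OF that(4), of "p + n"] that by simp
      then show False using antisym q that by force
    qed
    ultimately show ?thesis ..
  qed
  have inner': "\<exists>p. C p \<and> p < q \<and> q < p + n \<and> p < c \<and> c < p + n" if "\<not> C q" "(q, c) \<in> E" for q c
  proof -
    obtain p where "C p" "p \<le> q" "q < p + n" using C_below by blast
    then show ?thesis using that inner[of p q c] by (metis order_le_less)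
  qed
  define E' where "E' = {(p, c). if C p then p - n < c else (p, c) \<in> E}"
  have E'_iff: "(p, c) \<in> E' \<longleftrightarrow> (if C p then p - n < c else (p, c) \<in> E)" for p c
    by (simp add: E'_def)
  have not_to_C: False if "\<not> C q" "C c" "(q, c) \<in> E" for q c
    using inner'[OF that(1,3)] C_gap[of _ c] that(2) by fastforce
  have "tree_order n E'"
  proof
    show "(a, a) \<in> E'" for a using n_pos refl by (simp add: E'_iff)
    show "a = b" if ab: "(a, b) \<in> E'" "(b, a) \<in> E'" for a b
    proof (cases "C a \<and> C b")
      case True
      then show ?thesis using ab C_gap[of a b] C_gap[of b a] by (force simp: E'_iff)
    next
      case False
      then have "\<not> C a \<and> \<not> C b" using ab not_to_C by (metis E'_iff)
      then show ?thesis using ab antisym by (simp add: E'_iff)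
    qed
    show "(a, c) \<in> E'" if abc: "(a, b) \<in> E'" "(b, c) \<in> E'" for a b c
    proof (cases "C a")
      case True
      then have "a - n < b" using that by (simp add: E'_iff)
      have "a - n < c"
      proof (cases "C b")
        case Cb: True
        then have "a \<le> b" using \<open>a - n < b\<close> True C_gap[of b a] by force
        then show ?thesis using that Cb by (simp add: E'_iff)
      next
        case False
        then obtain p where p: "C p" "b < p + n" "p < c"
          using inner'[of b c] abc by (auto simp: E'_iff)
        then have "a - n \<le> p"
          using C_gap[of p "a - n"] C_shift True \<open>a - n < b\<close> by force
        then show ?thesis using p by simp
      qed
      then show ?thesis using True by (simp add: E'_iff)
    next
      case False
      then have "(a, b) \<in> E" using abc by (simp add: E'_iff)
      moreover from this have "\<not> C b" using not_to_C False by blast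
      then have "(b, c) \<in> E" using abc by (simp add: E'_iff)
      ultimately have "(a, c) \<in> E" by (rule trans)
      then show ?thesis using False by (simp add: E'_iff)
    qed
    show "(p, x) \<in> E'" if "(p, c) \<in> E'" "p \<le> x" "x \<le> c" for p c x
      using that convex_right n_pos by (auto simp: E'_iff split: if_splits)
    show "(p, x) \<in> E'" if "(p, c) \<in> E'" "c \<le> x" "x \<le> p" for p c x
      using that convex_left by (auto simp: E'_iff split: if_splits)
    show "\<exists>m\<ge>a. m \<le> b \<and> (m, a) \<in> E' \<and> (m, b) \<in> E'" if "a \<le> b" for a b
    proof (cases "\<exists>p. C p \<and> a \<le> p \<and> p \<le> b")
      case True
      then obtain q where q: "C q" "a \<le> q" "q \<le> b" by blast
      \<comment> \<open>The topmost element is now the lowest spine node in \<open>[a, b]\<close>, that is, the largest one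
        below \<open>a + n\<close>.\<close>
      obtain p where p: "C p" "p \<le> a + n - 1" "a + n - 1 < p + n" using C_below by blast
      then have "p \<le> q" using C_gap[of q p] q by force
      then have "(p, a) \<in> E'" "(p, b) \<in> E'" "a \<le> p" "p \<le> b"
        using p q by (auto simp: E'_iff)
      then show ?thesis by blast
    next
      case False
      obtain m where "a \<le> m" "m \<le> b" "(m, a) \<in> E" "(m, b) \<in> E"
        using top[OF \<open>a \<le> b\<close>] by blast
      then show ?thesis using False by (auto simp: E'_iff)
    qed
    show "(a + n, b + n) \<in> E' \<longleftrightarrow> (a, b) \<in> E'" for a b
      using shift C_shift by (auto simp: E'_iff)
  qed (rule n_pos)
  moreover have "\<not> adjacent E' (k + n) k" for k
  proof
    assume "adjacent E' (k + n) k"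
    then have "\<not> C (k + n)" "(k + n, k) \<in> E" by (auto simp: adjacent_def E'_iff split: if_splits)
    then show False using inner'[of "k + n" k] by force
  qed
  ultimately have "coreal_order n E'" by (simp add: coreal_order_def)
  moreover have "near_descents n E' = near_descents n E"
    using C_descendants by (auto simp: near_descents_def E'_iff split: if_splits)
  ultimately show thesis using that by blast
qed

lemma real_order_with_same_near_descents:
  assumes "coreal_order n E"
  obtains E' where "real_order n E'" "near_descents n E' = near_descents n E"
proof -
  obtain F where F: "coreal_order n F" "near_descents n F = near_descents n (mirror E)"
    using assms coreal_order_with_same_near_descents[of n "mirror E"] by auto
  have "near_descents n (mirror F) = near_descents n E"
    using F assms near_descents_mirror_subset[of n F "mirror E"]
      near_descents_mirror_subset[of n "mirror E" F] tree_order.tree_order_mirror[of n E]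
    by (auto simp: coreal_order_def)
  then show thesis using that[of "mirror F"] F by simp
qed

definition real_order_poset :: "int \<Rightarrow> int rel poset" where
  "real_order_poset n = induced_poset {E. real_order n E} (\<lambda>E F. right_descents E \<subseteq> right_descents F)"

definition coreal_order_poset :: "int \<Rightarrow> int rel poset" where
  "coreal_order_poset n = induced_poset {E. coreal_order n E} (\<lambda>E F. right_descents E \<subseteq> right_descents F)"

lemma is_poset_real_order_poset: "is_poset (real_order_poset n)"
proof -
  have "E = F" if "real_order n E" "real_order n F"
    "right_descents E \<subseteq> right_descents F" "right_descents F \<subseteq> right_descents E" for E F
    using that tree_order_eqI[of n E F] by (simp add: real_order_def)
  then show ?thesis
    unfolding is_poset_def real_order_poset_def induced_poset_def partial_order_on_def preorder_on_def
    by (auto simp: refl_on_def intro!: transI antisymI)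
qed

lemma real_order_eqI:
  assumes "real_order n E" "real_order n F" "near_descents n E = near_descents n F"
  shows "E = F"
proof (rule tree_order_eqI[of n])
  show "right_descents E = right_descents F"
    using real_order_right_descents_subset_iff[OF assms(1,2)]
      real_order_right_descents_subset_iff[OF assms(2,1)] assms(3) by simp
qed (use assms in \<open>simp_all add: real_order_def\<close>)

lemma coreal_order_eqI:
  assumes "coreal_order n E" "coreal_order n F" "near_descents n E = near_descents n F"
  shows "E = F"
proof (rule tree_order_eqI[of n])
  show "right_descents E = right_descents F"
    using coreal_order_right_descents_subset_iff[OF assms(1,2)]
      coreal_order_right_descents_subset_iff[OF assms(2,1)] assms(3) by simp
qed (use assms in \<open>simp_all add: coreal_order_def\<close>)

text \<open>Near descents starting in a set of representatives modulo \<open>n\<close> already determine the relation.\<close>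

lemma finite_real_orders: "finite {E. real_order n E}"
proof (rule inj_on_finite)
  let ?f = "\<lambda>E. near_descents n E \<inter> {0..<n} \<times> UNIV"
  show "?f ` {E. real_order n E} \<subseteq> Pow ({0..<n} \<times> {0..<2 * n})"
    by (auto simp: near_descents_def)
  show "finite (Pow ({0..<n} \<times> {0..<2 * n}))" by simp
  show "inj_on ?f {E. real_order n E}"
  proof (rule inj_onI)
    fix E F assume "E \<in> {E. real_order n E}" "F \<in> {E. real_order n E}" and eq: "?f E = ?f F"
    then have real: "real_order n E" "real_order n F" by simp_all
    interpret E: tree_order n E using real by (simp add: real_order_def)
    interpret F: tree_order n F using real by (simp add: real_order_def)
    have "(a, b) \<in> near_descents n E \<longleftrightarrow> (a, b) \<in> near_descents n F" for a b
    proof -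
      have "(a mod n, b - a div n * n) \<in> ?f E \<longleftrightarrow> (a mod n, b - a div n * n) \<in> ?f F"
        using eq by simp
      moreover have "a - a div n * n = a mod n"
        by (simp add: minus_div_mult_eq_mod)
      then have "0 \<le> a - a div n * n" "a - a div n * n < n"
        using E.n_pos by simp_all
      ultimately show ?thesis
        using E.shift_multiple[of "a mod n" "a div n" "b - a div n * n"]
          F.shift_multiple[of "a mod n" "a div n" "b - a div n * n"]
        by (auto simp: near_descents_def minus_div_mult_eq_mod[symmetric])
    qed
    then show "E = F" by (intro real_order_eqI[OF real] subset_antisym subrelI) simp_all
  qed
qed

lemma real_order_poset_iso_dual_coreal:
  "poset_isomorphic (real_order_poset n) (dual_poset (coreal_order_poset n))"
  unfolding real_order_poset_def coreal_order_poset_def dual_poset_induced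
proof (rule poset_isomorphicI)
  show "bij_betw mirror {E. real_order n E} {E. coreal_order n E}"
    by (rule bij_betw_byWitness[where f' = mirror]) auto
  show "right_descents E \<subseteq> right_descents F \<longleftrightarrow> right_descents (mirror F) \<subseteq> right_descents (mirror E)"
    if "E \<in> {E. real_order n E}" "F \<in> {E. real_order n E}" for E F
    using right_descents_mirror_subset_iff[of n E F] that by (simp add: real_order_def)
qed

text \<open>Each real relation is sent to the co-real one with the same near descents.\<close>

lemma real_order_poset_iso_coreal:
  "poset_isomorphic (real_order_poset n) (coreal_order_poset n)"
proof -
  define f where "f E = (SOME F. coreal_order n F \<and> near_descents n F = near_descents n E)" for E
  have f: "coreal_order n (f E)" "near_descents n (f E) = near_descents n E" if E: "real_order n E" for E
  proof -
    have "\<exists>F. coreal_order n F \<and> near_descents n F = near_descents n E"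
      using coreal_order_with_same_near_descents[OF E] by metis
    from someI_ex[OF this] show "coreal_order n (f E)" "near_descents n (f E) = near_descents n E"
      by (simp_all add: f_def)
  qed
  show ?thesis
    unfolding real_order_poset_def coreal_order_poset_def
  proof (rule poset_isomorphicI)
    show "right_descents E \<subseteq> right_descents F \<longleftrightarrow> right_descents (f E) \<subseteq> right_descents (f F)"
      if "E \<in> {E. real_order n E}" "F \<in> {E. real_order n E}" for E F
      using that f real_order_right_descents_subset_iff[of n E F]
        coreal_order_right_descents_subset_iff[of n "f E" "f F"]
      by simp
    have "inj_on f {E. real_order n E}"
    proof (rule inj_onI)
      show "E = F" if "E \<in> {E. real_order n E}" "F \<in> {E. real_order n E}" "f E = f F" for E F
        using that f(2)[of E] f(2)[of F] real_order_eqI[of n E F] by simp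
    qed
    moreover have "\<exists>E. real_order n E \<and> F = f E" if F: "coreal_order n F" for F
    proof -
      obtain E where E: "real_order n E" "near_descents n E = near_descents n F"
        using real_order_with_same_near_descents[OF F] .
      then have "F = f E"
        using coreal_order_eqI[OF F f(1)[OF E(1)]] f(2)[OF E(1)] by simp
      then show ?thesis using E by blast
    qed
    ultimately show "bij_betw f {E. real_order n E} {E. coreal_order n E}"
      using f by (auto simp: bij_betw_def image_iff)
  qed
qed

lemma self_dual_real_order_poset: "self_dual (real_order_poset n)"
  using poset_isomorphic_trans[OF real_order_poset_iso_dual_coreal
      poset_isomorphic_dual[OF poset_isomorphic_sym[OF real_order_poset_iso_coreal]]]
  unfolding self_dual_def .

section \<open>Translation-invariant total orders that avoid 312\<close>

text \<open>A node \<open>p\<close> is an ancestor of \<open>c\<close> if it comes last among all integers between \<open>p\<close> and \<open>c\<close>,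
as in a Cartesian tree.\<close>

definition tree_of_order :: "int rel \<Rightarrow> int rel" where
  "tree_of_order r = {(p, c). \<forall>x. min p c \<le> x \<and> x \<le> max p c \<longrightarrow> (x, p) \<in> r}"

text \<open>Post-order: a descendant precedes its ancestors, and incomparable nodes are read from left to right.
For \<open>a < b\<close> this leaves \<open>b\<close> before \<open>a\<close> exactly if \<open>b\<close> is in the right subtree of \<open>a\<close>.\<close>

definition order_of_tree :: "int rel \<Rightarrow> int rel" where
  "order_of_tree E = {(a, b). (b, a) \<in> E \<or> a < b \<and> (a, b) \<notin> E}"

lemma order_of_tree_iff: "(a, b) \<in> order_of_tree E \<longleftrightarrow> (b, a) \<in> E \<or> a < b \<and> (a, b) \<notin> E"
  by (simp add: order_of_tree_def)

lemma titoD: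
  assumes "tito n r"
  shows "(a, a) \<in> r"
    and "(a, b) \<in> r \<Longrightarrow> (b, c) \<in> r \<Longrightarrow> (a, c) \<in> r"
    and "(a, b) \<in> r \<Longrightarrow> (b, a) \<in> r \<Longrightarrow> a = b"
    and "(a, b) \<in> r \<or> (b, a) \<in> r"
    and "(a + n, b + n) \<in> r \<longleftrightarrow> (a, b) \<in> r"
proof -
  have r: "linear_order r" "\<And>a b. (a, b) \<in> r \<longleftrightarrow> (a + n, b + n) \<in> r"
    using assms by (auto simp: tito_def)
  show refl: "(a, a) \<in> r" for a using r(1) by (auto simp: order_on_defs refl_on_def)
  show "(a, b) \<in> r \<Longrightarrow> (b, c) \<in> r \<Longrightarrow> (a, c) \<in> r"
    using r(1) by (auto simp: order_on_defs dest: transD)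
  show "(a, b) \<in> r \<Longrightarrow> (b, a) \<in> r \<Longrightarrow> a = b"
    using r(1) by (auto simp: order_on_defs dest: antisymD)
  show "(a, b) \<in> r \<or> (b, a) \<in> r"
    using r(1) refl by (cases "a = b") (auto simp: order_on_defs total_on_def)
  show "(a + n, b + n) \<in> r \<longleftrightarrow> (a, b) \<in> r" using r(2) by blast
qed

lemma titoI:
  assumes "\<And>a. (a, a) \<in> r"
    and "\<And>a b c. (a, b) \<in> r \<Longrightarrow> (b, c) \<in> r \<Longrightarrow> (a, c) \<in> r"
    and "\<And>a b. (a, b) \<in> r \<Longrightarrow> (b, a) \<in> r \<Longrightarrow> a = b"
    and "\<And>a b. (a, b) \<in> r \<or> (b, a) \<in> r"
    and "\<And>a b. (a + n, b + n) \<in> r \<longleftrightarrow> (a, b) \<in> r"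
  shows "tito n r"
  unfolding tito_def order_on_defs refl_on_def trans_def antisym_def total_on_def
  using assms by (auto | blast)+

lemma tito_has_max:
  assumes "tito n r" "finite A" "A \<noteq> {}"
  shows "\<exists>m \<in> A. \<forall>x \<in> A. (x, m) \<in> r"
  using assms(2,3)
proof (induction A rule: finite_ne_induct)
  case (singleton x)
  then show ?case using titoD(1)[OF assms(1)] by simp
next
  case (insert y A)
  then obtain m where "m \<in> A" "\<forall>x \<in> A. (x, m) \<in> r" by blast
  show ?case
  proof (cases "(y, m) \<in> r")
    case True
    then show ?thesis using \<open>m \<in> A\<close> \<open>\<forall>x \<in> A. (x, m) \<in> r\<close> by blast
  next
    case False
    then have "(m, y) \<in> r" using titoD(4)[OF assms(1)] by blast
    then have "\<forall>x \<in> insert y A. (x, y) \<in> r"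
      using \<open>\<forall>x \<in> A. (x, m) \<in> r\<close> titoD(1,2)[OF assms(1)] by blast
    then show ?thesis by blast
  qed
qed

lemma tree_of_order_refl:
  assumes "(a, a) \<in> r" shows "(a, a) \<in> tree_of_order r"
  using assms by (auto simp: tree_of_order_def dest: order_antisym)

text \<open>The topmost element of \<open>[a, b]\<close> is the one that the total order puts last.\<close>

lemma tree_order_tree_of_order:
  assumes "tito n r" "0 < n" shows "tree_order n (tree_of_order r)"
proof
  note r = titoD[OF assms(1)]
  show "0 < n" by fact
  show "(a, a) \<in> tree_of_order r" for a
    using r(1) by (rule tree_of_order_refl)
  show "a = b" if "(a, b) \<in> tree_of_order r" "(b, a) \<in> tree_of_order r" for a b
    using that r(3)[of a b] by (auto simp: tree_of_order_def)
  show "(a, c) \<in> tree_of_order r" if "(a, b) \<in> tree_of_order r" "(b, c) \<in> tree_of_order r" for a b c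
  proof -
    have ab: "(x, a) \<in> r" if "min a b \<le> x" "x \<le> max a b" for x
      using that \<open>(a, b) \<in> _\<close> by (simp add: tree_of_order_def)
    have bc: "(x, b) \<in> r" if "min b c \<le> x" "x \<le> max b c" for x
      using that \<open>(b, c) \<in> _\<close> by (simp add: tree_of_order_def)
    have "(x, a) \<in> r" if "min a c \<le> x" "x \<le> max a c" for x
    proof (cases "min a b \<le> x \<and> x \<le> max a b")
      case False
      then have "(x, b) \<in> r" using bc that by (auto simp: min_def max_def split: if_splits)
      then show ?thesis using r(2) ab[of b] by simp
    qed (use ab in simp)
    then show ?thesis by (simp add: tree_of_order_def)
  qed
  show "(p, x) \<in> tree_of_order r" if "(p, c) \<in> tree_of_order r" "p \<le> x" "x \<le> c" for p c x
    using that by (auto simp: tree_of_order_def)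
  show "(p, x) \<in> tree_of_order r" if "(p, c) \<in> tree_of_order r" "c \<le> x" "x \<le> p" for p c x
    using that by (auto simp: tree_of_order_def)
  show "\<exists>m\<ge>a. m \<le> b \<and> (m, a) \<in> tree_of_order r \<and> (m, b) \<in> tree_of_order r" if ab: "a \<le> b" for a b
  proof -
    obtain m where "m \<in> {a..b}" "\<forall>x \<in> {a..b}. (x, m) \<in> r"
      using tito_has_max[OF assms(1), of "{a..b}"] ab by auto
    then show ?thesis by (intro exI[of _ m]) (auto simp: tree_of_order_def)
  qed
  show "(a + n, b + n) \<in> tree_of_order r \<longleftrightarrow> (a, b) \<in> tree_of_order r" for a b
  proof -
    have "(\<forall>x. P (x + n)) \<longleftrightarrow> (\<forall>x. P x)" for P :: "int \<Rightarrow> bool"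
      by (metis diff_add_cancel)
    from this[of "\<lambda>x. min (a + n) (b + n) \<le> x \<and> x \<le> max (a + n) (b + n) \<longrightarrow> (x, a + n) \<in> r"]
    show ?thesis
      using r(5) by (simp add: tree_of_order_def flip: min_add_distrib_left max_add_distrib_left)
  qed
qed

context tree_order
begin

lemma tito_order_of_tree: "tito n (order_of_tree E)"
proof (rule titoI)
  show "(a, c) \<in> order_of_tree E" if abc: "(a, b) \<in> order_of_tree E" "(b, c) \<in> order_of_tree E" for a b c
  proof -
    consider "(b, a) \<in> E" "(c, b) \<in> E" | "(b, a) \<in> E" "b < c" "(b, c) \<notin> E"
      | "a < b" "(a, b) \<notin> E" "(c, b) \<in> E" | "a < b" "b < c" "(a, b) \<notin> E" "(b, c) \<notin> E"
      using abc by (auto simp: order_of_tree_iff)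
    then show ?thesis
    proof cases
      case 1
      then show ?thesis using trans by (auto simp: order_of_tree_iff)
    next
      case 2
      then have "a < c" using convex_right[of b a c] by force
      moreover have "(a, c) \<notin> E" using 2 trans by blast
      ultimately show ?thesis by (simp add: order_of_tree_iff)
    next
      case 3
      then have "(a, c) \<notin> E" using trans by blast
      moreover have "(c, a) \<in> E" if "c \<le> a"
        using convex_right[of c b a] 3 that by simp
      ultimately show ?thesis by (auto simp: order_of_tree_iff)
    next
      case 4
      then show ?thesis using convex_right[of a c b] by (auto simp: order_of_tree_iff)
    qed
  qed
  show "a = b" if "(a, b) \<in> order_of_tree E" "(b, a) \<in> order_of_tree E" for a b
    using that antisym by (auto simp: order_of_tree_iff)
  show "(a, b) \<in> order_of_tree E \<or> (b, a) \<in> order_of_tree E" for a b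
    using refl by (cases a b rule: linorder_cases) (auto simp: order_of_tree_iff)
qed (use refl shift in \<open>auto simp: order_of_tree_iff\<close>)

lemma avoids_312_order_of_tree: "avoids_312 (order_of_tree E)"
  unfolding avoids_312_def
  using convex_right antisym by (fastforce simp: order_of_tree_iff)

lemma tree_of_order_of_tree: "tree_of_order (order_of_tree E) = E"
proof -
  have "(p, c) \<in> tree_of_order (order_of_tree E)" if "(p, c) \<in> E" for p c
    using convex_left[OF that] convex_right[OF that]
    by (cases "p \<le> c") (auto simp: tree_of_order_def order_of_tree_iff)
  moreover have "(p, c) \<in> E" if "(p, c) \<in> tree_of_order (order_of_tree E)" for p c
  proof -
    obtain m where m: "min p c \<le> m" "m \<le> max p c" "(m, p) \<in> E" "(m, c) \<in> E"
      using top[of p c] top[of c p] by (cases p c rule: le_cases) auto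
    then have "(m, p) \<in> order_of_tree E" using that by (simp add: tree_of_order_def)
    moreover have "(p, m) \<in> order_of_tree E" using m by (simp add: order_of_tree_iff)
    ultimately have "p = m" using titoD(3)[OF tito_order_of_tree] by blast
    then show ?thesis using m by simp
  qed
  ultimately show ?thesis by auto
qed

text \<open>If \<open>k\<close> is the right child of \<open>p\<close>, then post-order reads nothing between them: the critical case is a
descendant \<open>x\<close> of \<open>p\<close> with a label greater than \<open>k\<close>. The topmost element of \<open>[k, x]\<close> lies
below \<open>p\<close> and above \<open>k\<close> in the tree, so it is \<open>k\<close>, and \<open>x\<close> is a descendant of \<open>k\<close> and read before \<open>k\<close>.\<close>

lemma adjacent_order_of_tree:
  assumes "p < k" shows "adjacent (order_of_tree E) k p \<longleftrightarrow> adjacent E p k"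
proof
  assume adj: "adjacent (order_of_tree E) k p"
  then have "(p, k) \<in> E" using assms by (auto simp: adjacent_def order_of_tree_iff)
  then show "adjacent E p k"
    using adj assms by (auto simp: adjacent_def order_of_tree_iff)
next
  assume adj: "adjacent E p k"
  have "x = k \<or> x = p" if x: "(k, x) \<in> order_of_tree E" "(x, p) \<in> order_of_tree E" for x
  proof -
    consider "(p, x) \<in> E" "(x, k) \<in> E" | "(p, x) \<in> E" "k < x" "(k, x) \<notin> E"
      | "x < p" "(x, p) \<notin> E" "(x, k) \<in> E"
      using \<open>p < k\<close> x by (auto simp: order_of_tree_iff)
    then show ?thesis
    proof cases
      case 1
      then show ?thesis using adj by (auto simp: adjacent_def)
    next
      case 2
      obtain m where m: "k \<le> m" "m \<le> x" "(m, k) \<in> E" "(m, x) \<in> E"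
        using top[of k x] 2 by auto
      then have "(p, m) \<in> E" using convex_right[of p x m] 2 assms by simp
      then have "m = k" using adj m assms by (force simp: adjacent_def)
      then show ?thesis using m 2 by simp
    next
      case 3
      then show ?thesis using convex_right[of x k p] assms by simp
    qed
  qed
  then show "adjacent (order_of_tree E) k p"
    using adj by (auto simp: adjacent_def order_of_tree_iff)
qed

end

text \<open>If \<open>b\<close> precedes \<open>a\<close>, then no \<open>x\<close> between the two labels can come after \<open>a\<close>, for \<open>b\<close>, \<open>a\<close>, \<open>x\<close> would
form the pattern 312.\<close>

lemma avoids_312_inversion:
  assumes "tito n r" "avoids_312 r" "a < b"
  shows "(b, a) \<in> r \<longleftrightarrow> (a, b) \<in> tree_of_order r"
proof
  assume ba: "(b, a) \<in> r"
  have "(x, a) \<in> r" if "a \<le> x" "x \<le> b" for x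
  proof (cases "x = a \<or> x = b")
    case False
    then have "\<not> (a, x) \<in> r"
      using assms(2) ba that unfolding avoids_312_def by (metis order_le_less)
    then show ?thesis using titoD(4)[OF assms(1)] by blast
  qed (use ba titoD(1)[OF assms(1)] in auto)
  then show "(a, b) \<in> tree_of_order r" using assms(3) by (simp add: tree_of_order_def)
qed (use assms(3) in \<open>simp add: tree_of_order_def\<close>)

lemma order_of_tree_of_order:
  assumes "tito n r" "avoids_312 r"
  shows "order_of_tree (tree_of_order r) = r"
proof -
  note inv = avoids_312_inversion[OF assms]
  have "(b, a) \<in> r" if "(a, b) \<in> tree_of_order r" for a b
    using that by (simp add: tree_of_order_def)
  moreover have "(a, b) \<in> r" if "a < b" "(a, b) \<notin> tree_of_order r" for a b
    using inv[OF that(1)] titoD(4)[OF assms(1)] that by blast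
  moreover have "(b, a) \<in> tree_of_order r \<or> a < b \<and> (a, b) \<notin> tree_of_order r" if "(a, b) \<in> r" for a b
  proof (cases a b rule: linorder_cases)
    case less
    then show ?thesis using that inv[OF less] titoD(3)[OF assms(1), of a b] by auto
  next
    case equal
    then show ?thesis using tree_of_order_refl[OF titoD(1)[OF assms(1)]] by simp
  next
    case greater
    then show ?thesis using that inv[OF greater] by simp
  qed
  ultimately show ?thesis unfolding order_of_tree_def by blast
qed

definition inversions :: "int rel \<Rightarrow> int rel" where
  "inversions r = {(a, b). a < b \<and> (b, a) \<in> r}"

text \<open>The set of inverted pairs is closed under translation, so nothing is lost by passing to classes.\<close>

lemma dyer_le_iff:
  assumes "tito n r" "tito n s"
  shows "dyer_le n r s \<longleftrightarrow> inversions r \<subseteq> inversions s"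
proof
  assume "inversions r \<subseteq> inversions s"
  then show "dyer_le n r s"
    unfolding dyer_le_def Inv_def inversions_def[symmetric] quotient_def by blast
next
  assume le: "dyer_le n r s"
  show "inversions r \<subseteq> inversions s"
  proof (rule subrelI)
    fix a b assume ab: "(a, b) \<in> inversions r"
    then have "translation_equiv n `` {(a, b)} \<in> Inv n s"
      using le unfolding dyer_le_def Inv_def inversions_def[symmetric] by (blast intro: quotientI)
    then obtain c d where cd: "(c, d) \<in> inversions s"
      and eq: "translation_equiv n `` {(a, b)} = translation_equiv n `` {(c, d)}"
      unfolding Inv_def inversions_def[symmetric] by (auto elim!: quotientE)
    have "((a, b), (a, b)) \<in> translation_equiv n"
      unfolding translation_equiv_def by (auto intro!: exI[of _ 0])
    then have "((c, d), (a, b)) \<in> translation_equiv n"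
      using eq by blast
    then obtain k where "a = c + k * n" "b = d + k * n"
      by (auto simp: translation_equiv_def)
    then show "(a, b) \<in> inversions s"
      using cd shift_invariant_multiple[of n s] titoD(5)[OF assms(2)] by (simp add: inversions_def)
  qed
qed

section \<open>Negating a total order\<close>

lemma tito_mirror [simp]: "tito n (mirror r) \<longleftrightarrow> tito n r"
proof -
  have "tito n (mirror r)" if "tito n r" for r
  proof (rule titoI)
    note r = titoD[OF that]
    show "(a, c) \<in> mirror r" if "(a, b) \<in> mirror r" "(b, c) \<in> mirror r" for a b c
      using that r(2)[of "- a" "- b" "- c"] by simp
    show "a = b" if "(a, b) \<in> mirror r" "(b, a) \<in> mirror r" for a b
      using that r(3)[of "- a" "- b"] by simp
    show "(a + n, b + n) \<in> mirror r \<longleftrightarrow> (a, b) \<in> mirror r" for a b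
      using r(5)[of "- a - n" "- b - n"] by simp
  qed (use titoD[OF that] in simp_all)
  from this[of r] this[of "mirror r"] show ?thesis by auto
qed

lemma avoids_312_mirror [simp]: "avoids_312 (mirror r) \<longleftrightarrow> avoids_132 r"
proof -
  have neg: "(\<exists>a b c. P (- a) (- b) (- c)) \<longleftrightarrow> (\<exists>a b c. P a b c)" for P :: "int \<Rightarrow> int \<Rightarrow> int \<Rightarrow> bool"
    by (metis minus_minus)
  have "(\<exists>a b c. a < b \<and> b < c \<and> (c, a) \<in> mirror r \<and> (a, b) \<in> mirror r)
      \<longleftrightarrow> (\<exists>a b c. b < a \<and> c < b \<and> (c, a) \<in> r \<and> (a, b) \<in> r)"
    using neg[of "\<lambda>a b c. b < a \<and> c < b \<and> (c, a) \<in> r \<and> (a, b) \<in> r"] by simp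
  then show ?thesis unfolding avoids_312_def avoids_132_def by blast
qed

lemma avoids_132_mirror [simp]: "avoids_132 (mirror r) \<longleftrightarrow> avoids_312 r"
  using avoids_312_mirror[of "mirror r"] by simp

lemma inversions_mirror_subset_iff:
  assumes "tito n r" "tito n s"
  shows "inversions (mirror r) \<subseteq> inversions (mirror s) \<longleftrightarrow> inversions s \<subseteq> inversions r"
proof -
  have *: "inversions (mirror r) \<subseteq> inversions (mirror s)"
    if rs: "tito n r" "tito n s" and sub: "inversions s \<subseteq> inversions r" for r s
  proof (rule subrelI)
    fix a b assume "(a, b) \<in> inversions (mirror r)"
    then have ab: "a < b" "(- b, - a) \<in> r" by (auto simp: inversions_def)
    then have "(- a, - b) \<notin> r" using titoD(3)[OF rs(1), of "- a" "- b"] by auto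
    then have "(- a, - b) \<notin> s" using subsetD[OF sub, of "(- b, - a)"] ab by (auto simp: inversions_def)
    then show "(a, b) \<in> inversions (mirror s)"
      using titoD(4)[OF rs(2), of "- a" "- b"] ab by (simp add: inversions_def)
  qed
  show ?thesis
    using *[of r s] *[of "mirror s" "mirror r"] assms by auto
qed

section \<open>Blocks of size one\<close>

text \<open>Writing the period as \<open>d = n\<close> or \<open>d = - n\<close>, whichever is increasing in \<open>r\<close>, treats waxing and
waning residue classes at once.\<close>

lemma chain_order_iff:
  assumes r: "tito n r" and d: "d = n \<or> d = - n" "0 < n" and kd: "(k, k + d) \<in> r"
  shows "(k + i * d, k + j * d) \<in> r \<longleftrightarrow> i \<le> j"
proof -
  have shift: "(a + t * d, b + t * d) \<in> r \<longleftrightarrow> (a, b) \<in> r" for a b t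
    using shift_invariant_multiple[of n r a t b] shift_invariant_multiple[of n r a "- t" b]
      titoD(5)[OF r] d by auto
  have up: "(k + i * d, k + i * d + int t * d) \<in> r" for i t
  proof (induction t)
    case (Suc t)
    have "(k + i * d + int t * d, k + d + i * d + int t * d) \<in> r"
      using shift[of k "i + int t" "k + d"] kd by (simp add: algebra_simps)
    then show ?case using titoD(2)[OF r Suc] by (simp add: algebra_simps)
  qed (use titoD(1)[OF r] in simp)
  have le: "(k + i * d, k + j * d) \<in> r" if "i \<le> j" for i j
    using up[of i "nat (j - i)"] that by (simp add: algebra_simps)
  have "k + i * d \<noteq> k + j * d" if "i \<noteq> j" using that d by auto
  then show ?thesis
    using le[of i j] le[of j i] titoD(3)[OF r, of "k + i * d" "k + j * d"] by force
qed

lemma mod_eq_obtain: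
  fixes a k n :: int
  assumes "a mod n = k mod n" obtains t where "a = k + t * n"
proof -
  have "n dvd a - k" using assms by (simp add: mod_eq_dvd_iff)
  then obtain t where "a - k = n * t" by (rule dvdE)
  then show thesis using that[of t] by (simp add: algebra_simps)
qed

lemma residue_class_is_chain:
  fixes a k n d :: int
  assumes "d = n \<or> d = - n"
  shows "{a. a mod n = k mod n} = range (\<lambda>t. k + t * d)"
proof
  show "{a. a mod n = k mod n} \<subseteq> range (\<lambda>t. k + t * d)"
  proof clarify
    fix a assume "a mod n = k mod n"
    then obtain t where "a = k + t * n" by (rule mod_eq_obtain)
    then have "a = k + t * d \<or> a = k + - t * d" using assms by auto
    then show "a \<in> range (\<lambda>t. k + t * d)" by blast
  qed
  have "(k + t * d) mod n = k mod n" for t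
    using assms mod_mult_self1[of k "- t" n] by auto
  then show "range (\<lambda>t. k + t * d) \<subseteq> {a. a mod n = k mod n}" by auto
qed

text \<open>If \<open>k + d\<close> immediately follows \<open>k\<close>, then by translation the residue class of \<open>k\<close> is a discrete
chain without gaps, hence a block.\<close>

lemma block_of_adjacent:
  assumes r: "tito n r" and n: "0 < n" and d: "d = n \<or> d = - n"
    and adj: "adjacent r k (k + d)"
  shows "is_block r (range (\<lambda>t. k + t * d))" "block_size n (range (\<lambda>t. k + t * d)) = 1"
proof -
  let ?I = "range (\<lambda>t. k + t * d)"
  have kd: "(k, k + d) \<in> r" using adj by (simp add: adjacent_def)
  note chain = chain_order_iff[OF r d n kd]
  have step: "adjacent r (k + t * d) (k + d + t * d)" for t
    using adjacent_shift_multiple[of n r k t "k + d"] adjacent_shift_multiple[of n r k "- t" "k + d"]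
      titoD(5)[OF r] adj d
    by auto
  have up: "x \<in> (\<lambda>t. k + t * d) ` {i..i + int m}"
    if "(k + i * d, x) \<in> r" "(x, k + (i + int m) * d) \<in> r" for i m x
    using that
  proof (induction m)
    case 0
    then show ?case using titoD(3)[OF r, of x "k + i * d"] by simp
  next
    case (Suc m)
    show ?case
    proof (cases "(x, k + (i + int m) * d) \<in> r")
      case True
      then show ?thesis using Suc by fastforce
    next
      case False
      have end_eq: "k + d + (i + int m) * d = k + (i + int (Suc m)) * d" by (simp add: algebra_simps)
      have "(k + (i + int m) * d, x) \<in> r" using False titoD(4)[OF r] by blast
      then have "x = k + (i + int m) * d \<or> x = k + (i + int (Suc m)) * d"
        using step[of "i + int m"] Suc.prems(2) unfolding end_eq adjacent_def by blast
      then show ?thesis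
      proof
        assume "x = k + (i + int m) * d"
        then show ?thesis by (rule image_eqI) simp
      next
        assume "x = k + (i + int (Suc m)) * d"
        then show ?thesis by (rule image_eqI) simp
      qed
    qed
  qed
  have between: "{x. (k + i * d, x) \<in> r \<and> (x, k + j * d) \<in> r} \<subseteq> (\<lambda>t. k + t * d) ` {i..j}" for i j
  proof clarify
    fix x assume x: "(k + i * d, x) \<in> r" "(x, k + j * d) \<in> r"
    then have "i \<le> j" using chain titoD(2)[OF r] by blast
    then show "x \<in> (\<lambda>t. k + t * d) ` {i..j}" using up[of i x "nat (j - i)"] x by simp
  qed
  show "is_block r ?I"
    unfolding is_block_def
  proof (intro conjI)
    show "\<forall>a\<in>?I. \<forall>b\<in>?I. \<forall>x. (a, x) \<in> r \<and> (x, b) \<in> r \<longrightarrow> x \<in> ?I"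
      using between by blast
    show "\<forall>a\<in>?I. \<forall>b\<in>?I. finite {x. (a, x) \<in> r \<and> (x, b) \<in> r}"
      using finite_subset[OF between] by auto
    have less: "(k + t * d, k + (t + 1) * d) \<in> r" "k + t * d \<noteq> k + (t + 1) * d" for t
      using chain[of t "t + 1"] d n by (auto simp: distrib_right)
    show "\<not> (\<exists>m\<in>?I. \<forall>x\<in>?I. (x, m) \<in> r \<longrightarrow> x = m)"
    proof clarify
      fix t assume "\<forall>x\<in>?I. (x, k + t * d) \<in> r \<longrightarrow> x = k + t * d"
      then show False using less[of "t - 1"] by (metis diff_add_cancel rangeI)
    qed
    show "\<not> (\<exists>m\<in>?I. \<forall>x\<in>?I. (m, x) \<in> r \<longrightarrow> x = m)"
    proof clarify
      fix t assume "\<forall>x\<in>?I. (k + t * d, x) \<in> r \<longrightarrow> x = k + t * d"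
      then show False using less[of t] by (metis rangeI)
    qed
  qed simp
  have "{c \<in> {0..<n}. {a. a mod n = c} \<subseteq> ?I} = {k mod n}"
  proof -
    have "c = k mod n" if "c \<in> {0..<n}" "{a. a mod n = c} \<subseteq> {a. a mod n = k mod n}" for c
    proof -
      have "c mod n = c" using that(1) by simp
      then show ?thesis using that(2) by auto
    qed
    then show ?thesis using n unfolding residue_class_is_chain[OF d, symmetric] by auto
  qed
  then show "block_size n ?I = 1" by (simp add: block_size_def)
qed

text \<open>A block is locally finite, so every element \<open>a\<close> of it lies between two members of the residue class
\<open>k + n\<int>\<close> contained in it. By convexity the whole class of \<open>a\<close> is then in the block,
which leaves only \<open>k + n\<int>\<close> itself.\<close>

lemma size_one_block_obtain:
  assumes r: "tito n r" and n: "0 < n" and I: "is_block r I" "block_size n I = 1"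
  obtains k d where "d = n \<or> d = - n" "I = range (\<lambda>t. k + t * d)" "adjacent r k (k + d)"
proof -
  have convex: "\<And>a b x. a \<in> I \<Longrightarrow> b \<in> I \<Longrightarrow> (a, x) \<in> r \<Longrightarrow> (x, b) \<in> r \<Longrightarrow> x \<in> I"
    and fin: "\<And>a b. a \<in> I \<Longrightarrow> b \<in> I \<Longrightarrow> finite {x. (a, x) \<in> r \<and> (x, b) \<in> r}"
    using I(1) unfolding is_block_def by blast+
  obtain k where k: "{c \<in> {0..<n}. {a. a mod n = c} \<subseteq> I} = {k}"
    using I(2) by (auto simp: block_size_def card_1_singleton_iff)
  then have "k \<in> {c \<in> {0..<n}. {a. a mod n = c} \<subseteq> I}" by simp
  then have k_mod: "k mod n = k" and k_sub: "{a. a mod n = k mod n} \<subseteq> I" by auto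
  define d where "d = (if (k, k + n) \<in> r then n else - n)"
  have d: "d = n \<or> d = - n" by (simp add: d_def)
  have kd: "(k, k + d) \<in> r"
    using titoD(4)[OF r, of k "k + n"] titoD(5)[OF r, of k "k - n"] by (auto simp: d_def)
  note chain = chain_order_iff[OF r d n kd]
  have C: "k + t * d \<in> I" for t
    using k_sub unfolding residue_class_is_chain[OF d] by blast
  have inj: "inj (\<lambda>t. k + t * d)" using d n by (auto intro!: injI)
  have "a \<in> range (\<lambda>t. k + t * d)" if a: "a \<in> I" for a
  proof -
    have "\<exists>i. (k + i * d, a) \<in> r"
    proof (rule ccontr)
      assume "\<nexists>i. (k + i * d, a) \<in> r"
      then have "(\<lambda>t. k + t * d) ` {..0} \<subseteq> {x. (a, x) \<in> r \<and> (x, k + 0 * d) \<in> r}"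
        using titoD(4)[OF r] chain[of _ 0] by auto
      then have "finite ((\<lambda>t. k + t * d) ` {..0})"
        using fin[OF a C[of 0]] by (rule finite_subset)
      then show False
        using finite_imageD[OF _ inj_on_subset[OF inj subset_UNIV]] infinite_Iic by blast
    qed
    then obtain i where i: "(k + i * d, a) \<in> r" by blast
    have "\<exists>j. (a, k + j * d) \<in> r"
    proof (rule ccontr)
      assume "\<nexists>j. (a, k + j * d) \<in> r"
      then have "(\<lambda>t. k + t * d) ` {0..} \<subseteq> {x. (k + 0 * d, x) \<in> r \<and> (x, a) \<in> r}"
        using titoD(4)[OF r] chain[of 0] by auto
      then have "finite ((\<lambda>t. k + t * d) ` {0..})"
        using fin[OF C[of 0] a] by (rule finite_subset)
      then show False
        using finite_imageD[OF _ inj_on_subset[OF inj subset_UNIV]] infinite_Ici by blast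
    qed
    then obtain j where j: "(a, k + j * d) \<in> r" by blast
    have "{x. x mod n = a mod n} \<subseteq> I"
    proof clarify
      fix x assume "x mod n = a mod n"
      then obtain t where x: "x = a + t * n" by (rule mod_eq_obtain)
      have "(k + i * d + t * n, x) \<in> r" "(x, k + j * d + t * n) \<in> r"
        unfolding x using i j shift_invariant_multiple[of n r] titoD(5)[OF r] by blast+
      moreover have "k + s * d + t * n \<in> I" for s
      proof -
        have "k + s * d \<in> {a. a mod n = k mod n}" unfolding residue_class_is_chain[OF d] by blast
        then have "k + s * d + t * n \<in> {a. a mod n = k mod n}" by simp
        then show ?thesis using k_sub by blast
      qed
      ultimately show "x \<in> I" using convex by blast
    qed
    then have "a mod n \<in> {c \<in> {0..<n}. {a. a mod n = c} \<subseteq> I}" using n by simp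
    then have "a mod n = k mod n" unfolding k k_mod by simp
    then show ?thesis using residue_class_is_chain[OF d] by blast
  qed
  then have I: "I = range (\<lambda>t. k + t * d)" using C by blast
  have "z = k \<or> z = k + d" if "(k, z) \<in> r" "(z, k + d) \<in> r" for z
  proof -
    have "z \<in> I" using convex[OF C[of 0] C[of 1]] that by simp
    then obtain t where t: "z = k + t * d" by (auto simp: I)
    then have "0 \<le> t" "t \<le> 1" using chain[of 0 t] chain[of t 1] that by simp_all
    then have "t = 0 \<or> t = 1" by linarith
    then show ?thesis using t by auto
  qed
  then have "adjacent r k (k + d)" using kd d n by (auto simp: adjacent_def)
  then show thesis using that d I by blast
qed

lemma waxing_chain_iff:
  assumes r: "tito n r" and d: "d = n \<or> d = - n" "0 < n" and kd: "(k, k + d) \<in> r"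
  shows "waxing n r (range (\<lambda>t. k + t * d)) \<longleftrightarrow> d = n"
proof
  assume "waxing n r (range (\<lambda>t. k + t * d))"
  then have "(k + 0 * d, k + 0 * d + n) \<in> r" unfolding waxing_def by blast
  then show "d = n"
    using d chain_order_iff[OF assms, of 0 "- 1"] by auto
next
  assume "d = n"
  then show "waxing n r (range (\<lambda>t. k + t * d))"
    using chain_order_iff[OF assms, of t "t + 1" for t] by (auto simp: waxing_def distrib_right add.assoc)
qed

lemma size_one_block_iff:
  assumes r: "tito n r" and n: "0 < n"
  shows "(\<exists>I. is_block r I \<and> block_size n I = 1 \<and> waxing n r I) \<longleftrightarrow> (\<exists>k. adjacent r k (k + n))"
    and "(\<exists>I. is_block r I \<and> block_size n I = 1 \<and> waning n r I) \<longleftrightarrow> (\<exists>k. adjacent r k (k - n))"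
proof -
  have "\<exists>k. adjacent r k (k + (if waxing n r I then n else - n))"
    if I: "is_block r I" "block_size n I = 1" for I
  proof -
    obtain k d where kd: "d = n \<or> d = - n" "I = range (\<lambda>t. k + t * d)" "adjacent r k (k + d)"
      using size_one_block_obtain[OF r n I] .
    then have "waxing n r I \<longleftrightarrow> d = n"
      using waxing_chain_iff[OF r kd(1) n] by (simp add: adjacent_def)
    then show ?thesis using kd by auto
  qed
  then have block: "waxing n r I \<Longrightarrow> \<exists>k. adjacent r k (k + n)" "waning n r I \<Longrightarrow> \<exists>k. adjacent r k (k - n)"
    if "is_block r I" "block_size n I = 1" for I
    using that by (auto simp: waning_def dest!: meta_spec[of _ I])
  have adj: "\<exists>I. is_block r I \<and> block_size n I = 1 \<and> (waxing n r I \<longleftrightarrow> d = n)"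
    if "d = n \<or> d = - n" "adjacent r k (k + d)" for k d
    using block_of_adjacent[OF r n that] waxing_chain_iff[OF r that(1) n] that(2)
    by (intro exI[of _ "range (\<lambda>t. k + t * d)"]) (simp add: adjacent_def)
  show "(\<exists>I. is_block r I \<and> block_size n I = 1 \<and> waxing n r I) \<longleftrightarrow> (\<exists>k. adjacent r k (k + n))"
    using block adj[of n] by auto
  show "(\<exists>I. is_block r I \<and> block_size n I = 1 \<and> waning n r I) \<longleftrightarrow> (\<exists>k. adjacent r k (k - n))"
    using block adj[of "- n"] n by (auto simp: waning_def)
qed

lemma real_tito_iff:
  assumes "0 < n"
  shows "real_tito n r \<longleftrightarrow> tito n r \<and> (\<forall>k. \<not> adjacent r k (k - n))"
  using size_one_block_iff(2)[OF _ assms, of r] by (auto simp: real_tito_def waning_def)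

lemma coreal_tito_iff:
  assumes "0 < n"
  shows "coreal_tito n r \<longleftrightarrow> tito n r \<and> (\<forall>k. \<not> adjacent r k (k + n))"
  using size_one_block_iff(1)[OF _ assms, of r] by (auto simp: coreal_tito_def waning_def)

lemma real_tito_mirror:
  assumes "0 < n" shows "real_tito n (mirror r) \<longleftrightarrow> coreal_tito n r"
proof -
  have "(\<forall>k. P (- k)) \<longleftrightarrow> (\<forall>k. P k)" for P :: "int \<Rightarrow> bool"
    by (metis minus_minus)
  from this[of "\<lambda>k. \<not> adjacent r k (k + n)"] show ?thesis
    by (simp add: real_tito_iff coreal_tito_iff assms adjacent_mirror)
qed

lemma ATam_132_iso_dual_ATam_312:
  assumes "0 < n" shows "poset_isomorphic (ATam_132 n) (dual_poset (ATam_312 n))"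
  unfolding ATam_132_def ATam_312_def dual_poset_induced
proof (rule poset_isomorphicI)
  show "bij_betw mirror {r. coreal_tito n r \<and> avoids_132 r} {r. real_tito n r \<and> avoids_312 r}"
  proof (rule bij_betw_byWitness[where f' = mirror])
    have "coreal_tito n (mirror r) \<longleftrightarrow> real_tito n r" for r
      using real_tito_mirror[OF assms, of "mirror r"] by simp
    then show "mirror ` {r. real_tito n r \<and> avoids_312 r} \<subseteq> {r. coreal_tito n r \<and> avoids_132 r}"
      by auto
  qed (use real_tito_mirror[OF assms] in auto)
  fix r s assume "r \<in> {r. coreal_tito n r \<and> avoids_132 r}" "s \<in> {r. coreal_tito n r \<and> avoids_132 r}"
  then have rs: "tito n r" "tito n s" by (auto simp: coreal_tito_def)
  then show "dyer_le n r s \<longleftrightarrow> dyer_le n (mirror s) (mirror r)"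
    using inversions_mirror_subset_iff[OF rs(2,1)] by (simp add: dyer_le_iff)
qed

lemma ATam_312_iso_real_order_poset:
  assumes "0 < n" shows "poset_isomorphic (ATam_312 n) (real_order_poset n)"
  unfolding ATam_312_def real_order_poset_def
proof (rule poset_isomorphicI)
  have real: "real_order n E \<longleftrightarrow> real_tito n (order_of_tree E)" if "tree_order n E" for E
  proof -
    interpret tree_order n E by fact
    show ?thesis
      using adjacent_order_of_tree n_pos tito_order_of_tree that
      by (simp add: real_order_def real_tito_iff)
  qed
  show "bij_betw tree_of_order {r. real_tito n r \<and> avoids_312 r} {E. real_order n E}"
  proof (rule bij_betw_byWitness[where f' = order_of_tree])
    show "\<forall>r \<in> {r. real_tito n r \<and> avoids_312 r}. order_of_tree (tree_of_order r) = r"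
      using order_of_tree_of_order by (auto simp: real_tito_def)
    show "\<forall>E \<in> {E. real_order n E}. tree_of_order (order_of_tree E) = E"
      using tree_order.tree_of_order_of_tree by (auto simp: real_order_def)
    show "tree_of_order ` {r. real_tito n r \<and> avoids_312 r} \<subseteq> {E. real_order n E}"
    proof clarify
      fix r assume r: "real_tito n r" "avoids_312 r"
      then have "tito n r" by (simp add: real_tito_def)
      then show "real_order n (tree_of_order r)"
        using real[OF tree_order_tree_of_order[OF _ assms]] r order_of_tree_of_order by simp
    qed
    show "order_of_tree ` {E. real_order n E} \<subseteq> {r. real_tito n r \<and> avoids_312 r}"
      using real tree_order.avoids_312_order_of_tree by (auto simp: real_order_def)
  qed
  fix r s assume "r \<in> {r. real_tito n r \<and> avoids_312 r}" "s \<in> {r. real_tito n r \<and> avoids_312 r}"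
  then have rs: "tito n r" "avoids_312 r" "tito n s" "avoids_312 s" by (auto simp: real_tito_def)
  have "inversions r = right_descents (tree_of_order r)" if "tito n r" "avoids_312 r" for r
    using avoids_312_inversion[OF that] by (auto simp: inversions_def right_descents_def)
  then show "dyer_le n r s \<longleftrightarrow> right_descents (tree_of_order r) \<subseteq> right_descents (tree_of_order s)"
    using dyer_le_iff rs by simp
qed

section \<open>Binary trees and their in-order\<close>

lemma linear_order_subset_eq:
  assumes "linear_order r" "linear_order s" "r \<subseteq> s" shows "r = s"
proof
  show "s \<subseteq> r"
  proof (rule subrelI)
    fix a b assume ab: "(a, b) \<in> s"
    show "(a, b) \<in> r"
    proof (cases "a = b")
      case True
      then show ?thesis using assms(1) by (simp add: order_on_defs refl_on_def)
    next
      case False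
      then have "(b, a) \<notin> r" using assms(2,3) ab by (auto simp: order_on_defs dest: antisymD)
      then show ?thesis using assms(1) False by (auto simp: order_on_defs total_on_def)
    qed
  qed
qed fact

locale bintree =
  fixes T :: "'v bintree"
  assumes is_bintree: "is_bintree T"
begin

abbreviation D :: "'v \<Rightarrow> 'v set" where "D \<equiv> descendants T"
abbreviation L :: "'v \<Rightarrow> 'v set" where "L \<equiv> left_subtree T"
abbreviation R :: "'v \<Rightarrow> 'v set" where "R \<equiv> right_subtree T"

lemma descendants_iff: "w \<in> D v \<longleftrightarrow> (v, w) \<in> (parent_rel T)\<^sup>*"
  by (simp add: descendants_def)

lemma acyclic: "acyclic (parent_rel T)"
  using is_bintree by (simp add: is_bintree_def)

lemma unique_parent: "(p, c) \<in> parent_rel T \<Longrightarrow> (q, c) \<in> parent_rel T \<Longrightarrow> p = q"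
  using is_bintree by (auto simp: is_bintree_def)

lemma common_ancestor: "\<exists>w. u \<in> D w \<and> v \<in> D w"
  using is_bintree by (simp add: is_bintree_def)

lemma descendants_antisym: "v \<in> D w \<Longrightarrow> w \<in> D v \<Longrightarrow> v = w"
  using acyclic_impl_antisym_rtrancl[OF acyclic] by (auto simp: descendants_iff dest: antisymD)

lemma descendants_trans: "v \<in> D w \<Longrightarrow> u \<in> D v \<Longrightarrow> u \<in> D w"
  by (auto simp: descendants_iff)

lemma child_not_ancestor: "(p, c) \<in> parent_rel T \<Longrightarrow> p \<notin> D c"
  using acyclic by (auto simp: descendants_iff acyclic_def dest: rtrancl_into_trancl2)

lemma descendants_comparable: "w \<in> D u \<Longrightarrow> w \<in> D v \<Longrightarrow> v \<in> D u \<or> u \<in> D v"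
proof -
  assume "w \<in> D u" "w \<in> D v"
  moreover have "single_valued ((parent_rel T)\<inverse>)"
    using unique_parent by (auto simp: single_valued_def)
  ultimately show ?thesis
    using single_valued_confluent[of "(parent_rel T)\<inverse>" w u v]
    by (auto simp: descendants_iff rtrancl_converse)
qed

lemma child_descendants_disjoint:
  assumes "(p, c) \<in> parent_rel T" "(p, c') \<in> parent_rel T" "w \<in> D c" "w \<in> D c'"
  shows "c = c'"
proof -
  have *: "c = c'" if "(p, c) \<in> parent_rel T" "(p, c') \<in> parent_rel T" "c' \<in> D c" for c c'
  proof (rule ccontr)
    assume "c \<noteq> c'"
    then obtain q where "(c, q) \<in> (parent_rel T)\<^sup>*" "(q, c') \<in> parent_rel T"
      using \<open>c' \<in> D c\<close> by (auto simp: descendants_iff elim: rtranclE)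
    then have "p \<in> D c" using unique_parent that by (auto simp: descendants_iff)
    then show False using child_not_ancestor that by blast
  qed
  show ?thesis using *[OF assms(1,2)] *[OF assms(2,1)] descendants_comparable[OF assms(3,4)] by auto
qed

lemma left_subtree_iff: "w \<in> L v \<longleftrightarrow> (\<exists>c. lchild T v = Some c \<and> w \<in> D c)"
  by (simp add: left_subtree_def split: option.split)

lemma right_subtree_iff: "w \<in> R v \<longleftrightarrow> (\<exists>c. rchild T v = Some c \<and> w \<in> D c)"
  by (simp add: right_subtree_def split: option.split)

lemma left_right_disjoint: "w \<in> L v \<Longrightarrow> w \<in> R v \<Longrightarrow> False"
proof -
  assume "w \<in> L v" "w \<in> R v"
  then obtain c c' where "lchild T v = Some c" "rchild T v = Some c'" "w \<in> D c" "w \<in> D c'"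
    by (auto simp: left_subtree_iff right_subtree_iff)
  moreover from this have "c = c'"
    using child_descendants_disjoint[of v c c' w] by (simp add: parent_rel_def)
  ultimately show False using is_bintree by (auto simp: is_bintree_def)
qed

lemma descendants_cases: "w \<in> D v \<longleftrightarrow> w = v \<or> w \<in> L v \<or> w \<in> R v"
proof
  assume "w \<in> D v"
  then show "w = v \<or> w \<in> L v \<or> w \<in> R v"
    by (auto simp: descendants_iff left_subtree_iff right_subtree_iff parent_rel_def
        elim: converse_rtranclE)
next
  have "lchild T v = Some c \<or> rchild T v = Some c \<Longrightarrow> w \<in> D c \<Longrightarrow> w \<in> D v" for c
    by (auto simp: descendants_iff parent_rel_def intro: converse_rtrancl_into_rtrancl)
  then show "w = v \<or> w \<in> L v \<or> w \<in> R v \<Longrightarrow> w \<in> D v"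
    by (auto simp: left_subtree_iff right_subtree_iff) (simp add: descendants_iff)
qed

lemma not_in_own_subtrees: "v \<notin> L v" "v \<notin> R v"
  using child_not_ancestor by (auto simp: left_subtree_iff right_subtree_iff parent_rel_def)

lemma subtree_closed: "v \<in> L w \<Longrightarrow> u \<in> D v \<Longrightarrow> u \<in> L w" "v \<in> R w \<Longrightarrow> u \<in> D v \<Longrightarrow> u \<in> R w"
  using descendants_trans by (auto simp: left_subtree_iff right_subtree_iff)

text \<open>Walk from a common ancestor \<open>w\<close> of \<open>A\<close> down to \<open>a\<close>, and stop when the set \<open>A\<close> is no longer contained
in a single subtree of the current node.\<close>

lemma branching_ancestor_below:
  assumes "(w, a) \<in> (parent_rel T)\<^sup>*" "a \<in> A" "A \<subseteq> D w"
  shows "\<exists>v. A \<subseteq> D v \<and> \<not> A \<subseteq> L v \<and> \<not> A \<subseteq> R v"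
  using assms(1,3)
proof (induction rule: converse_rtrancl_induct)
  case base
  then show ?case using assms(2) not_in_own_subtrees by blast
next
  case (step w z)
  have a: "a \<in> D z" using step by (simp add: descendants_iff)
  have "A \<subseteq> D z" if A: "A \<subseteq> L w \<or> A \<subseteq> R w"
  proof -
    obtain c where c: "(w, c) \<in> parent_rel T" "A \<subseteq> D c"
      using A assms(2) by (auto simp: left_subtree_def right_subtree_def parent_rel_def split: option.splits)
    then have "c = z" using child_descendants_disjoint[OF c(1) step(1)] a assms(2) by blast
    then show ?thesis using c by simp
  qed
  then show ?case using step by blast
qed

lemma branching_ancestor:
  assumes "finite A" "A \<noteq> {}"
  obtains v where "A \<subseteq> D v" "\<not> A \<subseteq> L v" "\<not> A \<subseteq> R v"
proof -
  have "\<exists>w. A \<subseteq> D w"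
    using assms(1)
  proof (induction rule: finite_induct)
    case (insert x A)
    then obtain u where "A \<subseteq> D u" by blast
    moreover obtain w where "x \<in> D w" "u \<in> D w"
      using common_ancestor by blast
    ultimately show ?case using descendants_trans by blast
  qed simp
  then show thesis
    using branching_ancestor_below assms(2) that by (metis descendants_iff ex_in_conv subsetD)
qed

text \<open>The node \<open>w\<close> is the closest common ancestor of \<open>a\<close> and \<open>b\<close>, and it certifies that \<open>a\<close> precedes
\<open>b\<close> in in-order.\<close>

definition splits :: "'v \<Rightarrow> 'v \<Rightarrow> 'v \<Rightarrow> bool" where
  "splits w a b \<longleftrightarrow> a \<in> L w \<and> b = w \<or> a = w \<and> b \<in> R w \<or> a \<in> L w \<and> b \<in> R w"

lemma splits_descendants: "splits w a b \<Longrightarrow> a \<in> D w \<and> b \<in> D w"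
  using descendants_cases by (auto simp: splits_def)

lemma splits_not_same_subtree:
  "splits w a b \<Longrightarrow> \<not> (a \<in> L w \<and> b \<in> L w) \<and> \<not> (a \<in> R w \<and> b \<in> R w)"
  using left_right_disjoint not_in_own_subtrees unfolding splits_def by blast

text \<open>Two nodes certifying the order of \<open>a\<close> and \<open>b\<close> are both ancestors of \<open>a\<close>, so they are comparable;
neither lies in a subtree of the other, since \<open>a\<close> and \<open>b\<close> are not in the same subtree of either.\<close>

lemma splits_asym: "splits w a b \<Longrightarrow> splits v b a \<Longrightarrow> False"
proof -
  assume ab: "splits w a b" and ba: "splits v b a"
  have "v \<in> D w \<or> w \<in> D v"
    using splits_descendants[OF ab] splits_descendants[OF ba] descendants_comparable by blast
  moreover have "v = w" if vw: "v \<in> D w"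
  proof -
    have "v \<notin> L w" "v \<notin> R w"
      using subtree_closed splits_descendants[OF ba] splits_not_same_subtree[OF ab] by blast+
    then show ?thesis using descendants_cases[of v w] vw by simp
  qed
  moreover have "v = w" if wv: "w \<in> D v"
  proof -
    have "w \<notin> L v" "w \<notin> R v"
      using subtree_closed splits_descendants[OF ab] splits_not_same_subtree[OF ba] by blast+
    then show ?thesis using descendants_cases[of w v] wv by simp
  qed
  ultimately have "v = w" by blast
  then show False
    using ab ba left_right_disjoint not_in_own_subtrees unfolding splits_def by blast
qed

lemma ex_splits: "a \<noteq> b \<Longrightarrow> \<exists>w. splits w a b \<or> splits w b a"
proof -
  assume "a \<noteq> b"
  obtain v where "{a, b} \<subseteq> D v" "\<not> {a, b} \<subseteq> L v" "\<not> {a, b} \<subseteq> R v"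
    using branching_ancestor[of "{a, b}"] by blast
  moreover have "a = v \<or> a \<in> L v \<or> a \<in> R v" "b = v \<or> b \<in> L v \<or> b \<in> R v"
    using calculation(1) descendants_cases[of a v] descendants_cases[of b v] by simp_all
  ultimately have "splits v a b \<or> splits v b a"
    unfolding splits_def using \<open>a \<noteq> b\<close> by (elim disjE) simp_all
  then show ?thesis by blast
qed

text \<open>A cycle \<open>a\<close>, \<open>b\<close>, \<open>c\<close> is excluded at the lowest node \<open>w\<close> above all three: not all of them lie in the
same one of the three parts left subtree, \<open>w\<close> and right subtree of \<open>w\<close>, and the parts are ordered.\<close>

lemma splits_trans:
  assumes "splits u a b" "splits v b c" shows "\<exists>w. splits w a c"
proof (rule ccontr)
  assume no: "\<nexists>w. splits w a c"
  have "a \<noteq> c" using splits_asym assms by blast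
  then have "\<exists>w. splits w c a" using ex_splits no by blast
  then have not_splits: "\<not> splits w b a" "\<not> splits w c b" "\<not> splits w a c" for w
    using splits_asym assms by blast+
  have "a \<noteq> b" "b \<noteq> c" using splits_asym assms by blast+
  obtain w where "{a, b, c} \<subseteq> D w" "\<not> {a, b, c} \<subseteq> L w" "\<not> {a, b, c} \<subseteq> R w"
    using branching_ancestor[of "{a, b, c}"] by blast
  moreover have "a = w \<or> a \<in> L w \<or> a \<in> R w" "b = w \<or> b \<in> L w \<or> b \<in> R w"
    "c = w \<or> c \<in> L w \<or> c \<in> R w"
    using calculation(1) descendants_cases[of a w] descendants_cases[of b w] descendants_cases[of c w]
    by simp_all
  ultimately show False
    using not_splits(1)[of w, unfolded splits_def] not_splits(2)[of w, unfolded splits_def]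
      not_splits(3)[of w, unfolded splits_def] \<open>a \<noteq> b\<close> \<open>b \<noteq> c\<close> \<open>a \<noteq> c\<close>
    by (elim disjE) simp_all
qed

definition in_order_rel :: "'v rel" where
  "in_order_rel = {(a, b). a = b \<or> (\<exists>w. splits w a b)}"

lemma linear_in_order_rel: "linear_order in_order_rel"
  unfolding order_on_defs refl_on_def total_on_def
proof (intro conjI)
  show "trans in_order_rel"
    using splits_trans by (intro transI) (auto simp: in_order_rel_def)
  show "antisym in_order_rel"
    using splits_asym by (intro antisymI) (auto simp: in_order_rel_def)
  show "\<forall>x\<in>UNIV. \<forall>y\<in>UNIV. x \<noteq> y \<longrightarrow> (x, y) \<in> in_order_rel \<or> (y, x) \<in> in_order_rel"
    using ex_splits unfolding in_order_rel_def by blast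
qed (auto simp: in_order_rel_def)

lemma in_order_rel_precedes:
  "precedes in_order_rel (L v) {v} \<and> precedes in_order_rel {v} (R v)"
  using not_in_own_subtrees by (auto simp: precedes_def in_order_rel_def splits_def)

text \<open>The constraints contain the order of each pair at its closest common ancestor, so they leave no
choice.\<close>

lemma in_order_unique:
  assumes r: "linear_order r" and "\<And>v. precedes r (L v) {v} \<and> precedes r {v} (R v)"
  shows "r = in_order_rel"
proof (rule sym, rule linear_order_subset_eq)
  have "(a, b) \<in> r" if "splits w a b" for w a b
    using that assms(2)[of w] r unfolding splits_def precedes_def order_on_defs
    by (auto dest: transD)
  then show "in_order_rel \<subseteq> r"
    using r by (auto simp: in_order_rel_def order_on_defs refl_on_def)
qed (fact linear_in_order_rel r)+

lemma in_order_eq: "in_order T = in_order_rel"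
  unfolding in_order_def
  using in_order_unique linear_in_order_rel in_order_rel_precedes by (intro the_equality) blast+

lemma parent_rel_iff_adjacent: "(p, c) \<in> parent_rel T \<longleftrightarrow> adjacent ((parent_rel T)\<^sup>*) p c"
proof
  assume pc: "(p, c) \<in> parent_rel T"
  have "p \<noteq> c" using child_not_ancestor[OF pc] by (auto simp: descendants_iff)
  moreover have "z = p \<or> z = c" if "(p, z) \<in> (parent_rel T)\<^sup>*" "(z, c) \<in> (parent_rel T)\<^sup>*" for z
    using that(2)
  proof (cases rule: rtranclE)
    case (step q)
    then have "(z, p) \<in> (parent_rel T)\<^sup>*" using unique_parent[OF pc] by blast
    then show ?thesis using descendants_antisym that(1) by (auto simp: descendants_iff)
  qed simp
  ultimately show "adjacent ((parent_rel T)\<^sup>*) p c" using pc by (auto simp: adjacent_def)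
next
  assume adj: "adjacent ((parent_rel T)\<^sup>*) p c"
  then have "(p, c) \<in> (parent_rel T)\<^sup>*" "p \<noteq> c" by (auto simp: adjacent_def)
  then obtain z where z: "(p, z) \<in> parent_rel T" "(z, c) \<in> (parent_rel T)\<^sup>*"
    by (auto elim: converse_rtranclE)
  then have "z \<noteq> p" using child_not_ancestor[OF z(1)] by (auto simp: descendants_iff)
  moreover have "z = p \<or> z = c" using adj z by (auto simp: adjacent_def)
  ultimately show "(p, c) \<in> parent_rel T" using z by blast
qed

end

section \<open>Descendant relation and post-order of a TIBIT\<close>

locale in_ordered_tree =
  fixes n :: int and T :: "int bintree"
  assumes n_pos: "0 < n" and tibit: "tibit n T"

sublocale in_ordered_tree \<subseteq> bintree T
  using tibit by unfold_locales (simp add: tibit_def)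

context in_ordered_tree
begin

abbreviation E :: "int rel" where "E \<equiv> (parent_rel T)\<^sup>*"

lemma subtree_less: "w \<in> L v \<Longrightarrow> w < v" "w \<in> R v \<Longrightarrow> v < w"
proof -
  have "a < b \<longleftrightarrow> (a, b) \<in> in_order_rel \<and> a \<noteq> b" for a b
    using tibit in_order_eq by (simp add: tibit_def)
  then show "w \<in> L v \<Longrightarrow> w < v" "w \<in> R v \<Longrightarrow> v < w"
    using in_order_rel_precedes[of v] by (auto simp: precedes_def)
qed

lemma left_subtree_eq: "L v = {w. w < v \<and> (v, w) \<in> E}"
  using subtree_less descendants_cases[of _ v] by (fastforce simp: descendants_iff)

lemma right_subtree_eq: "R v = {w. v < w \<and> (v, w) \<in> E}"
  using subtree_less descendants_cases[of _ v] by (fastforce simp: descendants_iff)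

lemma parent_shift: "(a + n, b + n) \<in> parent_rel T \<longleftrightarrow> (a, b) \<in> parent_rel T"
  using tibit by (simp add: tibit_def parent_rel_def)

text \<open>Compare \<open>p\<close> and \<open>x\<close> at their closest common ancestor \<open>w\<close>. If \<open>w\<close> is not \<open>p\<close>, then \<open>p\<close> and its
descendant \<open>c\<close> lie on one side of \<open>w\<close>, and \<open>x\<close> is \<open>w\<close> or on the other side, so \<open>x\<close> is not between
\<open>p\<close> and \<open>c\<close>.\<close>

lemma convex_order:
  assumes "(p, c) \<in> E" "p \<le> x \<and> x \<le> c \<or> c \<le> x \<and> x \<le> p" shows "(p, x) \<in> E"
proof (rule ccontr)
  assume no: "(p, x) \<notin> E"
  obtain w where w: "{p, x} \<subseteq> D w" "\<not> {p, x} \<subseteq> L w" "\<not> {p, x} \<subseteq> R w"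
    using branching_ancestor[of "{p, x}"] by blast
  have c: "c \<in> D p" using assms(1) by (simp add: descendants_iff)
  have "p \<noteq> w" using w(1) no by (auto simp: descendants_iff)
  then consider "p \<in> L w" "x \<notin> L w" | "p \<in> R w" "x \<notin> R w"
    using w descendants_cases[of p w] by auto
  then show False
  proof cases
    case 1
    then have "p < w" "c < w" "w \<le> x"
      using subtree_closed c subtree_less w(1) descendants_cases[of x w] by (fastforce simp del: not_less)+
    then show False using assms(2) by linarith
  next
    case 2
    then have "w < p" "w < c" "x \<le> w"
      using subtree_closed c subtree_less w(1) descendants_cases[of x w] by (fastforce simp del: not_less)+
    then show False using assms(2) by linarith
  qed
qed

end

sublocale in_ordered_tree \<subseteq> E: tree_order n E
proof
  show "0 < n" by (rule n_pos)
  show "a = b" if "(a, b) \<in> E" "(b, a) \<in> E" for a b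
    using descendants_antisym that by (simp add: descendants_iff)
  show "\<exists>m\<ge>a. m \<le> b \<and> (m, a) \<in> E \<and> (m, b) \<in> E" if ab: "a \<le> b" for a b
  proof -
    obtain w where w: "{a, b} \<subseteq> D w" "\<not> {a, b} \<subseteq> L w" "\<not> {a, b} \<subseteq> R w"
      using branching_ancestor[of "{a, b}"] by blast
    then have "a \<le> w \<and> w \<le> b"
      using ab subtree_less descendants_cases[of a w] descendants_cases[of b w] by force
    then show ?thesis using w(1) by (auto simp: descendants_iff)
  qed
  show "(a + n, b + n) \<in> E \<longleftrightarrow> (a, b) \<in> E" for a b
  proof -
    have "(a + d, b + d) \<in> E" if "d = n \<or> d = - n" "(a, b) \<in> E" for a b d
      using that(2)
    proof (induction rule: rtrancl_induct)
      case (step y z)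
      have "(y + d, z + d) \<in> parent_rel T"
        using step(2) that(1) parent_shift[of y z] parent_shift[of "y - n" "z - n"] by auto
      then show ?case using step(3) by simp
    qed simp
    from this[of n a b] this[of "- n" "a + n" "b + n"] show ?thesis by auto
  qed
  show "(a, b) \<in> E \<Longrightarrow> (b, c) \<in> E \<Longrightarrow> (a, c) \<in> E" for a b c by simp
qed (use convex_order in blast)+

context in_ordered_tree
begin

text \<open>Each pair of labels is ordered by one of the constraints at the topmost element between them, so
the post-order is unique, and \<open>order_of_tree\<close> satisfies the constraints.\<close>

lemma post_order_eq: "post_order T = order_of_tree E"
  unfolding post_order_def
proof (rule the_equality)
  have lin: "linear_order (order_of_tree E)"
    using E.tito_order_of_tree by (simp add: tito_def)
  have "precedes (order_of_tree E) (L v) (R v)" for v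
    unfolding precedes_def
  proof (intro ballI)
    fix a b assume "a \<in> L v" "b \<in> R v"
    then have ab: "a < v" "v < b" "(v, a) \<in> E"
      by (simp_all add: left_subtree_eq right_subtree_eq)
    then have "(a, b) \<notin> E" using E.convex_right[of a b v] E.antisym[of a v] by auto
    then show "(a, b) \<in> order_of_tree E \<and> a \<noteq> b" using ab by (simp add: order_of_tree_iff)
  qed
  moreover have "precedes (order_of_tree E) (L v) {v}" "precedes (order_of_tree E) (R v) {v}" for v
    by (auto simp: precedes_def left_subtree_eq right_subtree_eq order_of_tree_iff)
  ultimately show "linear_order (order_of_tree E) \<and>
     (\<forall>v. precedes (order_of_tree E) (L v) (R v) \<and>
          precedes (order_of_tree E) (L v) {v} \<and> precedes (order_of_tree E) (R v) {v})"
    using lin by blast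
  fix r assume r: "linear_order r \<and> (\<forall>v. precedes r (L v) (R v) \<and>
          precedes r (L v) {v} \<and> precedes r (R v) {v})"
  have "(a, b) \<in> r" if ab: "(a, b) \<in> order_of_tree E" for a b
  proof (cases "(b, a) \<in> E")
    case True
    then show ?thesis
      using r by (cases a b rule: linorder_cases)
        (auto simp: precedes_def left_subtree_eq right_subtree_eq order_on_defs refl_on_def)
  next
    case False
    then have "a < b" "(a, b) \<notin> E" using ab by (auto simp: order_of_tree_iff)
    then obtain m where "a \<le> m" "m \<le> b" "(m, a) \<in> E" "(m, b) \<in> E"
      using E.top[of a b] by auto
    moreover from this have "m \<noteq> a" "m \<noteq> b" using False \<open>(a, b) \<notin> E\<close> by auto
    ultimately have "a \<in> L m" "b \<in> R m" by (simp_all add: left_subtree_eq right_subtree_eq)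
    then show ?thesis using r by (auto simp: precedes_def)
  qed
  then show "r = order_of_tree E"
    using linear_order_subset_eq[OF lin, of r] r by (auto simp: subset_iff)
qed

lemma child_iff:
  "lchild T p = Some c \<longleftrightarrow> c < p \<and> adjacent E p c"
  "rchild T p = Some c \<longleftrightarrow> p < c \<and> adjacent E p c"
proof -
  have "c \<in> D c" by (simp add: descendants_iff)
  then have "lchild T p = Some c \<Longrightarrow> c < p" "rchild T p = Some c \<Longrightarrow> p < c"
    using subtree_less by (auto simp: left_subtree_iff right_subtree_iff)
  then show "lchild T p = Some c \<longleftrightarrow> c < p \<and> adjacent E p c"
    "rchild T p = Some c \<longleftrightarrow> p < c \<and> adjacent E p c"
    unfolding parent_rel_iff_adjacent[symmetric] by (auto simp: parent_rel_def)
qed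

end

section \<open>The TIBIT of a descendant relation\<close>

definition the_option :: "('a \<Rightarrow> bool) \<Rightarrow> 'a option" where
  "the_option P = (if \<exists>x. P x then Some (THE x. P x) else None)"

lemma the_option_eq_Some_iff:
  assumes "\<And>x y. P x \<Longrightarrow> P y \<Longrightarrow> x = y"
  shows "the_option P = Some c \<longleftrightarrow> P c"
proof -
  have "(THE x. P x) = x" if "P x" for x
    using that assms by (intro the_equality)
  then show ?thesis using assms by (auto simp: the_option_def)
qed

definition tree_of :: "int rel \<Rightarrow> int bintree" where
  "tree_of E = BinTree (\<lambda>p. the_option (\<lambda>c. c < p \<and> adjacent E p c))
                       (\<lambda>p. the_option (\<lambda>c. p < c \<and> adjacent E p c))"

context tree_order
begin

text \<open>The topmost element between two left children would separate one of them from the parent.\<close>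

lemma adjacent_left_unique:
  assumes "c < p" "c' < p" "adjacent E p c" "adjacent E p c'" shows "c = c'"
proof -
  have "c = c'" if c: "c \<le> c'" "c < p" "c' < p" "adjacent E p c" "adjacent E p c'" for c c'
  proof -
    obtain m where m: "c \<le> m" "m \<le> c'" "(m, c) \<in> E" "(m, c') \<in> E"
      using top[OF c(1)] by blast
    have "(p, m) \<in> E" using convex_left[of p c m] that m by (simp add: adjacent_def)
    then have "m = c" "m = c'" using m that by (force simp: adjacent_def)+
    then show ?thesis by simp
  qed
  then show ?thesis using assms by (cases c c' rule: le_cases) auto
qed

lemma adjacent_right_unique:
  assumes "p < c" "p < c'" "adjacent E p c" "adjacent E p c'" shows "c = c'"
proof -
  interpret M: tree_order n "mirror E" by (rule tree_order_mirror)
  show ?thesis using M.adjacent_left_unique[of "- c" "- p" "- c'"] assms by (simp add: adjacent_mirror)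
qed

lemma tree_of_children:
  "lchild (tree_of E) p = Some c \<longleftrightarrow> c < p \<and> adjacent E p c"
  "rchild (tree_of E) p = Some c \<longleftrightarrow> p < c \<and> adjacent E p c"
  unfolding tree_of_def bintree.sel
  by (rule the_option_eq_Some_iff, use adjacent_left_unique adjacent_right_unique in blast)+

lemma parent_rel_tree_of: "(p, c) \<in> parent_rel (tree_of E) \<longleftrightarrow> adjacent E p c"
proof -
  have "adjacent E p c \<Longrightarrow> c < p \<or> p < c" by (auto simp: adjacent_def)
  then show ?thesis by (auto simp: parent_rel_def tree_of_children)
qed

text \<open>Finitely many nodes lie between an ancestor and a descendant, so every descent refines to a chain
of parent-child steps.\<close>

lemma rtrancl_parent_rel_tree_of: "(parent_rel (tree_of E))\<^sup>* = E"
proof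
  show "(parent_rel (tree_of E))\<^sup>* \<subseteq> E"
  proof (rule subrelI)
    fix a b assume "(a, b) \<in> (parent_rel (tree_of E))\<^sup>*"
    then show "(a, b) \<in> E"
      by induction (use refl trans in \<open>auto simp: parent_rel_tree_of adjacent_def\<close>)
  qed
  have "(p, c) \<in> (parent_rel (tree_of E))\<^sup>*" if "(p, c) \<in> E" for p c
    using that
  proof (induction "card {x. (p, x) \<in> E \<and> (x, c) \<in> E}" arbitrary: p c rule: less_induct)
    case (less p c)
    show ?case
    proof (cases "p = c \<or> adjacent E p c")
      case True
      then show ?thesis by (auto simp: parent_rel_tree_of)
    next
      case False
      then obtain x where x: "(p, x) \<in> E" "(x, c) \<in> E" "x \<noteq> p" "x \<noteq> c"
        using less.prems by (auto simp: adjacent_def)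
      have "card {y. (p, y) \<in> E \<and> (y, x) \<in> E} < card {y. (p, y) \<in> E \<and> (y, c) \<in> E}"
        using x less.prems refl trans antisym by (intro psubset_card_mono finite_between) blast
      then have "(p, x) \<in> (parent_rel (tree_of E))\<^sup>*"
        using less.hyps x by blast
      moreover have "card {y. (x, y) \<in> E \<and> (y, c) \<in> E} < card {y. (p, y) \<in> E \<and> (y, c) \<in> E}"
        using x less.prems refl trans antisym by (intro psubset_card_mono finite_between) blast
      then have "(x, c) \<in> (parent_rel (tree_of E))\<^sup>*"
        using less.hyps x by blast
      ultimately show ?thesis by (rule rtrancl_trans)
    qed
  qed
  then show "E \<subseteq> (parent_rel (tree_of E))\<^sup>*" by auto
qed

lemma is_bintree_tree_of: "is_bintree (tree_of E)"
  unfolding is_bintree_def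
proof (intro conjI allI impI)
  show "acyclic (parent_rel (tree_of E))"
  proof (rule acyclicI, intro allI notI)
    fix x assume "(x, x) \<in> (parent_rel (tree_of E))\<^sup>+"
    then obtain z where "adjacent E x z" "(z, x) \<in> E"
      by (auto dest!: tranclD simp: rtrancl_parent_rel_tree_of parent_rel_tree_of)
    then show False using antisym by (auto simp: adjacent_def)
  qed
  show "p = q" if "(p, c) \<in> parent_rel (tree_of E) \<and> (q, c) \<in> parent_rel (tree_of E)" for p q c
    using that ancestors_comparable[of p c q] by (auto simp: parent_rel_tree_of adjacent_def)
  show "\<not> (lchild (tree_of E) p = Some c \<and> rchild (tree_of E) p = Some c)" for p c
    by (simp add: tree_of_children)
  show "\<exists>w. u \<in> descendants (tree_of E) w \<and> v \<in> descendants (tree_of E) w" for u v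
    using top[of u v] top[of v u]
    by (cases u v rule: le_cases) (auto simp: descendants_def rtrancl_parent_rel_tree_of)
qed

lemma tibit_tree_of: "tibit n (tree_of E)"
proof -
  interpret B: bintree "tree_of E" by (rule bintree.intro) (rule is_bintree_tree_of)
  have "w < v" if w: "w \<in> left_subtree (tree_of E) v" for v w
  proof (rule ccontr)
    obtain c where c: "c < v" "adjacent E v c" "(c, w) \<in> E"
      using w by (auto simp: B.left_subtree_iff tree_of_children B.descendants_iff rtrancl_parent_rel_tree_of)
    moreover assume "\<not> w < v"
    ultimately have "(c, v) \<in> E" using convex_right[of c w v] by simp
    then show False using c antisym by (auto simp: adjacent_def)
  qed
  moreover have "v < w" if w: "w \<in> right_subtree (tree_of E) v" for v w
  proof (rule ccontr)
    obtain c where c: "v < c" "adjacent E v c" "(c, w) \<in> E"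
      using w by (auto simp: B.right_subtree_iff tree_of_children B.descendants_iff rtrancl_parent_rel_tree_of)
    moreover assume "\<not> v < w"
    ultimately have "(c, v) \<in> E" using convex_left[of c w v] by simp
    then show False using c antisym by (auto simp: adjacent_def)
  qed
  moreover have "linear_order {(a, b). (a :: int) \<le> b}"
    by (auto simp: order_on_defs refl_on_def total_on_def intro!: transI antisymI)
  ultimately have "in_order (tree_of E) = {(a, b). a \<le> b}"
    using B.in_order_unique[of "{(a, b). a \<le> b}"] by (force simp: B.in_order_eq precedes_def)
  moreover have "adjacent E (a + n) (b + n) \<longleftrightarrow> adjacent E a b" for a b
    using adjacent_shift_multiple[of n E a 1 b] shift by simp
  ultimately show ?thesis
    by (auto simp: tibit_def is_bintree_tree_of tree_of_children)
qed

end

lemma (in in_ordered_tree) tree_order: "tree_order n E" ..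

lemma (in in_ordered_tree) tree_of_descendants: "tree_of E = T"
proof (rule bintree.expand, intro conjI ext)
  have option_eqI: "x = y" if "\<And>c. x = Some c \<longleftrightarrow> y = Some c" for x y :: "int option"
    using that by (metis not_None_eq)
  show "lchild (tree_of E) p = lchild T p" "rchild (tree_of E) p = rchild T p" for p
    by (rule option_eqI, simp only: child_iff E.tree_of_children)+
qed

text \<open>The predicates \<open>P\<close> and \<open>Q\<close> stand for the condition of being real or co-real, on trees and on
descendant relations.\<close>

lemma tibit_poset_iso:
  assumes "0 < n"
    and P: "\<And>T. tibit n T \<Longrightarrow> P T \<longleftrightarrow> Q ((parent_rel T)\<^sup>*)"
  shows "poset_isomorphic (induced_poset {T. tibit n T \<and> P T} (tibit_le n))
    (induced_poset {E. tree_order n E \<and> Q E} (\<lambda>E F. right_descents E \<subseteq> right_descents F))"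
proof (rule poset_isomorphicI)
  let ?f = "\<lambda>T. (parent_rel T)\<^sup>*"
  show "bij_betw ?f {T. tibit n T \<and> P T} {E. tree_order n E \<and> Q E}"
  proof (rule bij_betw_byWitness[where f' = tree_of])
    have tree: "in_ordered_tree n T" if "tibit n T" for T
      using that assms(1) by (rule in_ordered_tree.intro[rotated])
    show "\<forall>T \<in> {T. tibit n T \<and> P T}. tree_of (?f T) = T"
      using tree in_ordered_tree.tree_of_descendants by blast
    show "\<forall>E \<in> {E. tree_order n E \<and> Q E}. ?f (tree_of E) = E"
      using tree_order.rtrancl_parent_rel_tree_of by blast
    show "?f ` {T. tibit n T \<and> P T} \<subseteq> {E. tree_order n E \<and> Q E}"
      using tree in_ordered_tree.tree_order P by auto
    show "tree_of ` {E. tree_order n E \<and> Q E} \<subseteq> {T. tibit n T \<and> P T}"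
      using tree_order.tibit_tree_of tree_order.rtrancl_parent_rel_tree_of P by fastforce
  qed
  fix S T assume "S \<in> {T. tibit n T \<and> P T}" "T \<in> {T. tibit n T \<and> P T}"
  then interpret S: in_ordered_tree n S + T: in_ordered_tree n T
    using assms(1) by (simp_all add: in_ordered_tree_def)
  have "inversions (order_of_tree E) = right_descents E" for E
    by (auto simp: inversions_def right_descents_def order_of_tree_iff)
  then show "tibit_le n S T \<longleftrightarrow> right_descents (?f S) \<subseteq> right_descents (?f T)"
    by (simp add: tibit_le_def S.post_order_eq T.post_order_eq dyer_le_iff
        S.E.tito_order_of_tree T.E.tito_order_of_tree)
qed

lemma tibit_parent_iff:
  assumes "tibit n T" shows "(p, c) \<in> parent_rel T \<longleftrightarrow> adjacent ((parent_rel T)\<^sup>*) p c"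
  using assms by (intro bintree.parent_rel_iff_adjacent bintree.intro) (simp add: tibit_def)

lemma ATam_real_Tree_iso_real_order_poset:
  assumes "0 < n" shows "poset_isomorphic (ATam_real_Tree n) (real_order_poset n)"
  unfolding ATam_real_Tree_def real_order_poset_def real_tibit_def real_order_def
  by (rule tibit_poset_iso[OF assms]) (simp add: tibit_parent_iff)

lemma ATam_coreal_Tree_iso_coreal_order_poset:
  assumes "0 < n" shows "poset_isomorphic (ATam_coreal_Tree n) (coreal_order_poset n)"
  unfolding ATam_coreal_Tree_def coreal_order_poset_def coreal_tibit_def coreal_order_def
  by (rule tibit_poset_iso[OF assms]) (simp add: tibit_parent_iff)

section \<open>The four posets\<close>

theorem corollary4p16:
  fixes n :: int
  assumes "n \<ge> 2"
  shows "(\<forall>P \<in> {ATam_312 n, ATam_132 n}. is_poset P \<and> finite (fst P) \<and> self_dual P) \<and>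
         (\<forall>P \<in> {ATam_real_Tree n, ATam_coreal_Tree n}. is_poset P \<and> finite (fst P) \<and> self_dual P) \<and>
         poset_isomorphic (ATam_312 n) (ATam_132 n) \<and>
         poset_isomorphic (ATam_312 n) (ATam_real_Tree n) \<and>
         poset_isomorphic (ATam_312 n) (ATam_coreal_Tree n) \<and>
         poset_isomorphic (ATam_132 n) (ATam_real_Tree n) \<and>
         poset_isomorphic (ATam_132 n) (ATam_coreal_Tree n) \<and>
         poset_isomorphic (ATam_real_Tree n) (ATam_coreal_Tree n)"
proof -
  have n: "0 < n" using assms by simp
  let ?Q = "real_order_poset n"
  have Q: "is_poset ?Q" "finite (fst ?Q)" "self_dual ?Q"
    using is_poset_real_order_poset self_dual_real_order_poset finite_real_orders
    by (simp_all add: real_order_poset_def induced_poset_def)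
  have a: "poset_isomorphic (ATam_312 n) ?Q" "poset_isomorphic (ATam_real_Tree n) ?Q"
    using ATam_312_iso_real_order_poset[OF n] ATam_real_Tree_iso_real_order_poset[OF n] by simp_all
  have c: "poset_isomorphic (ATam_coreal_Tree n) ?Q"
    using ATam_coreal_Tree_iso_coreal_order_poset[OF n]
      poset_isomorphic_sym[OF real_order_poset_iso_coreal] by (rule poset_isomorphic_trans)
  have "poset_isomorphic (ATam_132 n) (dual_poset ?Q)"
    using ATam_132_iso_dual_ATam_312[OF n] poset_isomorphic_dual[OF a(1)]
    by (rule poset_isomorphic_trans)
  then have b: "poset_isomorphic (ATam_132 n) ?Q"
    using poset_isomorphic_sym[OF Q(3)[unfolded self_dual_def]] by (rule poset_isomorphic_trans)
  have good: "is_poset P \<and> finite (fst P) \<and> self_dual P"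
    if "poset_isomorphic P ?Q" "P = induced_poset A le" for P :: "'a poset" and A le
    using is_poset_iso[OF that(1) Q(1)] finite_iso[OF that(1) Q(2)] self_dual_iso[OF that(1) Q(3)]
    by (auto simp: that(2) induced_poset_def)
  note pair = poset_isomorphic_trans[OF _ poset_isomorphic_sym]
  show ?thesis
    using good[OF a(1) ATam_312_def] good[OF b ATam_132_def]
      good[OF a(2) ATam_real_Tree_def] good[OF c ATam_coreal_Tree_def]
      pair[OF a(1) b] pair[OF a] pair[OF a(1) c] pair[OF b a(2)] pair[OF b c] pair[OF a(2) c]
    by simp
qed

end
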